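(* Let $n \ge 1$ and let $A = \begin{bmatrix} E & F \\ F^T & G \end{bmatrix}$ be a $2n \times 2n$ real (symmetric) positive definite matrix, where $E, F, G$ are $n \times n$ real blocks. Then $$d(E \oplus G) \prec^w d(A),$$ that is, the vector of symplectic eigenvalues of the block-diagonal matrix $E \oplus G = \begin{bmatrix} E & 0 \\ 0 & G \end{bmatrix}$ is weakly supermajorized by the vector of symplectic eigenvalues of $A$.
   Context: Let $J_{2n} = \begin{bmatrix} 0 & I_n \\ -I_n & 0 \end{bmatrix}$. A real $2n\times 2n$ matrix $M$ is symplectic if $M^T J_{2n} M = J_{2n}$. Williamson's theorem: for every $2n \times 2n$ real positive definite matrix $A$ there is a symplectic $M$ with $M^T A M = D \oplus D$, where $D$ is an $n\times n$ diagonal matrix with positive diagonal entries, unique up to permutation of its diagonal entries. The diagonal entries of $D$ are the symplectic eigenvalues of $A$, and $d(A) = [d_1(A),\ldots,d_n(A)]^T$ denotes the $n$-vector of the symplectic eigenvalues of $A$ (with multiplicity) arranged in non-decreasing order. For $x \in \mathbb{R}^n$ let $x_1^\uparrow \le \cdots \le x_n^\uparrow$ denote its entries arranged in non-decreasing order. For $x,y\in\mathbb{R}^n$, $x$ is weakly supermajorized by $y$, written $x \prec^w y$, if $\sum_{j=1}^k x_j^\uparrow \ge \sum_{j=1}^k y_j^\uparrow$ for all $1 \le k \le n$. *)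

theory Defs
  imports Complex_Main "Jordan_Normal_Form.Matrix"
begin

definition J_mat :: "nat \<Rightarrow> real mat" where
  "J_mat n = four_block_mat (0\<^sub>m n n) (1\<^sub>m n) (- 1\<^sub>m n) (0\<^sub>m n n)"

definition symplectic_mat :: "nat \<Rightarrow> real mat \<Rightarrow> bool" where
  "symplectic_mat n M \<longleftrightarrow>
     M \<in> carrier_mat (2 * n) (2 * n) \<and> transpose_mat M * J_mat n * M = J_mat n"

definition positive_definite :: "real mat \<Rightarrow> bool" where
  "positive_definite A \<longleftrightarrow>
     square_mat A \<and> transpose_mat A = A \<and>
     (\<forall>v \<in> carrier_vec (dim_row A). v \<noteq> 0\<^sub>v (dim_row A) \<longrightarrow> v \<bullet> (A *\<^sub>v v) > 0)"

definition direct_sum_mat :: "real mat \<Rightarrow> real mat \<Rightarrow> real mat" where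
  "direct_sum_mat A B =
     four_block_mat A (0\<^sub>m (dim_row A) (dim_col B)) (0\<^sub>m (dim_row B) (dim_col A)) B"

definition williamson_form :: "nat \<Rightarrow> real mat \<Rightarrow> real mat \<Rightarrow> bool" where
  "williamson_form n A D \<longleftrightarrow>
     D \<in> carrier_mat n n \<and> diagonal_mat D \<and> (\<forall>i<n. D $$ (i, i) > 0) \<and>
     (\<exists>M. symplectic_mat n M \<and> transpose_mat M * A * M = direct_sum_mat D D)"

(* The diagonal of D in non-decreasing order. By Williamson's theorem such a D exists for every
   2n x 2n positive definite A, and its diagonal is unique up to permutation; so the description
   then denotes. For other matrices A the value carries no meaning. *)
definition symplectic_eigenvalues :: "nat \<Rightarrow> real mat \<Rightarrow> real vec" where
  "symplectic_eigenvalues n A =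
     (THE d. \<exists>D. williamson_form n A D \<and> d = vec_of_list (sort (diag_mat D)))"

(* List positions count from 0: sort (list_of_vec x) ! j is the (j+1)-st smallest entry of x. *)
definition weakly_supermajorized :: "nat \<Rightarrow> real vec \<Rightarrow> real vec \<Rightarrow> bool" where
  "weakly_supermajorized n x y \<longleftrightarrow>
     x \<in> carrier_vec n \<and> y \<in> carrier_vec n \<and>
     (\<forall>k. 1 \<le> k \<and> k \<le> n \<longrightarrow>
        (\<Sum>j<k. sort (list_of_vec x) ! j) \<ge> (\<Sum>j<k. sort (list_of_vec y) ! j))"

end

(*
Since E (+) G is the average of A and U A U with U = diag(I, -I), and U reverses the sign of the
symplectic form, everything reduces to a bound on traces: a system s of 2k vectors with Gram matrix
J_2k with respect to J_2n satisfies
  sum_c s_c . A s_c  >=  2 (d_1 + ... + d_k),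
with equality for suitable columns of a Williamson basis. Take such an optimal system for E (+) G:
it and its image under U (with the two halves exchanged) are both admissible for A.

For the bound, pass to A = D (+) D and let S be the 2n x 2k matrix of the system. A Gram-Schmidt
argument gives an orthonormal basis w_0, w_1, ... of R^2k such that the modes l < i div 2 of S w_i
vanish. Then 1 = |omega(S w_i, S J w_i)| only involves modes with d_l >= d_(i div 2), and
the inequality of arithmetic and geometric means, summed over i, gives the bound. Applied to A itself
it also shows that the symplectic eigenvalues are unique.

Williamson's theorem is proved by splitting off planes: J A is skew for the inner product
given by A, so an eigenvector x + iy of J A inside an invariant subspace yields, after scaling,
A x = d J y and A y = -d J x.
*)
theory Submission
  imports Defs "Jordan_Normal_Form.Determinant" "HOL-Combinatorics.List_Permutation"
    "HOL-Computational_Algebra.Fundamental_Theorem_Algebra"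
begin

section \<open>Linear systems and orthonormal bases\<close>

text \<open>Padding the \<open>m\<close> equations with zero rows gives a square matrix with a zero
  row. Its determinant vanishes, so its kernel is nontrivial.\<close>

lemma homogeneous_system_nontrivial:
  fixes r :: "nat \<Rightarrow> 'a::field vec"
  assumes "m < N" and "\<And>j. j < m \<Longrightarrow> r j \<in> carrier_vec N"
  shows "\<exists>v\<in>carrier_vec N. v \<noteq> 0\<^sub>v N \<and> (\<forall>j<m. r j \<bullet> v = 0)"
proof -
  define c where "c = (\<lambda>i. if i < m then r i else 0\<^sub>v N)"
  \<comment> \<open>The redundant test \<open>i = m\<close> puts the matrix into the form that
    \<open>det_row_0\<close> expects.\<close>
  define A where "A = mat\<^sub>r N N (\<lambda>i. if i = m then 0\<^sub>v N else c i)"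
  have A: "A \<in> carrier_mat N N" by (simp add: A_def)
  have "det A = 0"
    unfolding A_def by (rule det_row_0) (use assms in \<open>auto simp: c_def\<close>)
  then obtain v where v: "v \<in> carrier_vec N" "v \<noteq> 0\<^sub>v N" "A *\<^sub>v v = 0\<^sub>v N"
    using det_0_iff_vec_prod_zero_field[OF A] by blast
  have "r j \<bullet> v = 0" if "j < m" for j
  proof -
    have "row A j = r j"
      using that assms by (auto simp: A_def c_def)
    moreover have "(A *\<^sub>v v) $ j = row A j \<bullet> v"
      using A that assms(1) by simp
    ultimately show ?thesis using v(3) that assms(1) by simp
  qed
  with v show ?thesis by blast
qed

lemma scalar_prod_self_pos:
  fixes v :: "real vec"
  assumes "v \<in> carrier_vec N" "v \<noteq> 0\<^sub>v N"
  shows "0 < v \<bullet> v"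
proof -
  obtain i where i: "i < N" "v $ i \<noteq> 0"
    using assms by (metis carrier_vecD eq_vecI index_zero_vec)
  have "0 < (\<Sum>j\<in>{0..<N}. v $ j * v $ j)"
    by (rule sum_pos2[of _ i]) (use i in \<open>auto simp: zero_less_mult_iff\<close>)
  then show ?thesis using assms by (simp add: scalar_prod_def)
qed

text \<open>The basis is built backwards: \<open>w (N-1)\<close>, which has to annihilate the most
  rows, is chosen first. Each new vector must also be orthogonal to those already chosen, and at
  every stage the two kinds of conditions together number fewer than \<open>N\<close>.\<close>

lemma triangularizing_orthonormal_basis:
  fixes r :: "nat \<Rightarrow> real vec"
  assumes r: "\<And>j. j < N \<Longrightarrow> r j \<in> carrier_vec N"
  obtains w where "\<And>i. i < N \<Longrightarrow> w i \<in> carrier_vec N"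
    and "\<And>i j. i < N \<Longrightarrow> j < N \<Longrightarrow> w i \<bullet> w j = (if i = j then 1 else 0)"
    and "\<And>i j. i < N \<Longrightarrow> j < i \<Longrightarrow> r j \<bullet> w i = 0"
proof -
  \<comment> \<open>Here \<open>v t\<close> stands for \<open>w (N-1-t)\<close>, so the bound
    \<open>N-1-t\<close> on \<open>j\<close> is the index of that basis vector.\<close>
  define good where "good T v \<longleftrightarrow> (\<forall>t<T. v t \<in> carrier_vec N \<and>
      (\<forall>s<T. v t \<bullet> v s = (if t = s then 1 else 0)) \<and> (\<forall>j<N-1-t. r j \<bullet> v t = 0))" for T v
  have goodD: "t < T \<Longrightarrow> v t \<in> carrier_vec N"
    "t < T \<Longrightarrow> s < T \<Longrightarrow> v t \<bullet> v s = (if t = s then 1 else 0)"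
    "t < T \<Longrightarrow> j < N-1-t \<Longrightarrow> r j \<bullet> v t = 0" if "good T v" for T v t s j
    using that unfolding good_def by simp_all
  have "\<exists>v. good T v" if "T \<le> N" for T
    using that
  proof (induction T)
    case 0
    then show ?case by (simp add: good_def)
  next
    case (Suc T)
    then obtain v where "good T v" by auto
    note v = goodD[OF this]
    \<comment> \<open>The next vector has to satisfy \<open>T + (N - 1 - T) = N - 1\<close> linear conditions.\<close>
    define f where "f = (\<lambda>j. if j < T then v j else r (j - T))"
    have "\<exists>u\<in>carrier_vec N. u \<noteq> 0\<^sub>v N \<and> (\<forall>j<N-1. f j \<bullet> u = 0)"
      by (rule homogeneous_system_nontrivial) (use Suc.prems v(1) r in \<open>auto simp: f_def\<close>)
    then obtain u where u: "u \<in> carrier_vec N" "u \<noteq> 0\<^sub>v N" "\<And>j. j < N-1 \<Longrightarrow> f j \<bullet> u = 0"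
      by blast
    have pos: "0 < u \<bullet> u" by (rule scalar_prod_self_pos[OF u(1,2)])
    define u' where "u' = (1 / sqrt (u \<bullet> u)) \<cdot>\<^sub>v u"
    have u': "u' \<in> carrier_vec N" using u by (simp add: u'_def)
    have uu: "u' \<bullet> u' = 1" using u pos by (simp add: u'_def)
    have vu: "v t \<bullet> u' = 0" if "t < T" for t
      using u(3)[of t] that Suc.prems u(1) v(1)[OF that] by (simp add: u'_def f_def)
    have uv: "u' \<bullet> v t = 0" if "t < T" for t
      using vu[OF that] comm_scalar_prod[OF v(1)[OF that] u'] by simp
    have ru: "r j \<bullet> u' = 0" if "j < N-1-T" for j
      using u(3)[of "T + j"] that u(1) r[of j] by (simp add: u'_def f_def)
    have "good (Suc T) (v(T := u'))"
      using v u' uu vu uv ru by (auto simp: good_def less_Suc_eq)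
    then show ?case by blast
  qed
  from this[OF order_refl] obtain v where "good N v" by blast
  note v = goodD[OF this]
  show ?thesis
    by (rule that[of "\<lambda>i. v (N - 1 - i)"]) (use v in auto)
qed

text \<open>The matrix with rows \<open>w i\<close> is orthogonal and therefore preserves
  norms.\<close>

lemma parseval:
  fixes w :: "nat \<Rightarrow> real vec"
  assumes w: "\<And>i. i < N \<Longrightarrow> w i \<in> carrier_vec N"
    and orth: "\<And>i j. i < N \<Longrightarrow> j < N \<Longrightarrow> w i \<bullet> w j = (if i = j then 1 else 0)"
    and r: "r \<in> carrier_vec N"
  shows "(\<Sum>i<N. (r \<bullet> w i)\<^sup>2) = r \<bullet> r"
proof -
  define W where "W = mat N N (\<lambda>(i, j). w i $ j)"
  have W: "W \<in> carrier_mat N N" by (simp add: W_def)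
  have rowW: "row W i = w i" if "i < N" for i
    using that w[OF that] by (auto simp: W_def)
  have "W * transpose_mat W = 1\<^sub>m N"
    using W by (intro eq_matI) (auto simp: rowW orth)
  then have inv: "transpose_mat W * W = 1\<^sub>m N"
    using mat_mult_left_right_inverse[OF W] W by simp
  have "(\<Sum>i<N. (r \<bullet> w i)\<^sup>2) = (W *\<^sub>v r) \<bullet> (W *\<^sub>v r)"
    using W r w by (auto simp: scalar_prod_def[of "W *\<^sub>v r"] rowW power2_eq_square lessThan_atLeast0
        comm_scalar_prod[of _ N r] intro!: sum.cong)
  also have "\<dots> = r \<bullet> (transpose_mat W *\<^sub>v (W *\<^sub>v r))"
    using W r transpose_vec_mult_scalar[of "transpose_mat W" N N "W *\<^sub>v r" r] by simp
  also have "\<dots> = r \<bullet> r"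
    using assoc_mult_mat_vec[of "transpose_mat W" N N W N r] W r inv by simp
  finally show ?thesis .
qed

section \<open>The symplectic form\<close>

lemma J_mat_eq:
  "J_mat n = mat (2*n) (2*n) (\<lambda>(i, j). if j = n + i then 1 else if i = n + j then -1 else 0)"
  unfolding J_mat_def by (rule eq_matI) auto

lemma J_mat_carrier [simp]: "J_mat n \<in> carrier_mat (2*n) (2*n)"
  by (simp add: J_mat_eq)

lemma J_mat_dims [simp]: "dim_row (J_mat n) = 2*n" "dim_col (J_mat n) = 2*n"
  by (simp_all add: J_mat_eq)

lemma index_J_mat:
  assumes "i < 2*n" "j < 2*n"
  shows "J_mat n $$ (i, j) = (if j = n + i then 1 else if i = n + j then -1 else 0)"
  using assms by (simp add: J_mat_eq)

lemma sum_double: "(\<Sum>i<2*n. f i) = (\<Sum>i<n. f i + f (n + i))" for f :: "nat \<Rightarrow> 'a::comm_monoid_add"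
proof -
  have "(\<Sum>i<2*n. f i) = (\<Sum>i<n. f i) + (\<Sum>i\<in>{n..<2*n}. f i)"
    by (subst sum.union_disjoint[symmetric]) (auto intro!: sum.cong)
  also have "(\<Sum>i\<in>{n..<2*n}. f i) = (\<Sum>i<n. f (n + i))"
    by (rule sum.reindex_bij_witness[of _ "\<lambda>i. n + i" "\<lambda>i. i - n"]) auto
  finally show ?thesis by (simp add: sum.distrib)
qed

lemma J_mat_mult_vec:
  assumes v: "v \<in> carrier_vec (2*n)"
  shows "J_mat n *\<^sub>v v = vec (2*n) (\<lambda>i. if i < n then v $ (n + i) else - v $ (i - n))"
proof (rule eq_vecI)
  fix i assume "i < dim_vec (vec (2*n) (\<lambda>i. if i < n then v $ (n + i) else - v $ (i - n)))"
  then have i: "i < 2*n" by simp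
  \<comment> \<open>Row \<open>i\<close> of \<open>J_mat n\<close> has a single nonzero entry: the
    sign \<open>s\<close> in column \<open>a\<close>.\<close>
  define a where "a = (if i < n then n + i else i - n)"
  define s :: real where "s = (if i < n then 1 else -1)"
  have a: "a < 2*n" using i by (auto simp: a_def)
  have "(J_mat n *\<^sub>v v) $ i = (\<Sum>j = 0..<2*n. (if j = a then s * v $ j else 0))"
    unfolding index_mult_mat_vec[of i "J_mat n" v, unfolded J_mat_dims, OF i] scalar_prod_def carrier_vecD[OF v]
    by (rule sum.cong) (use i in \<open>auto simp: J_mat_eq a_def s_def\<close>)
  also have "\<dots> = s * v $ a"
    using a by simp
  finally show "(J_mat n *\<^sub>v v) $ i = vec (2*n) (\<lambda>i. if i < n then v $ (n + i) else - v $ (i - n)) $ i"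
    using i by (auto simp: a_def s_def)
qed simp

lemma J_mat_J_mat_vec [simp]:
  assumes v: "v \<in> carrier_vec (2*n)"
  shows "J_mat n *\<^sub>v (J_mat n *\<^sub>v v) = - v"
  by (rule eq_vecI) (use v in \<open>auto simp: J_mat_mult_vec\<close>)

lemma J_mat_sq: "J_mat n * J_mat n = - 1\<^sub>m (2*n)"
proof (rule eq_matI)
  fix i j assume ij: "i < dim_row (- 1\<^sub>m (2*n) :: real mat)" "j < dim_col (- 1\<^sub>m (2*n) :: real mat)"
  have "(J_mat n * J_mat n) $$ (i, j) = (J_mat n *\<^sub>v col (J_mat n) j) $ i"
    using ij by simp
  also have "\<dots> = (- 1\<^sub>m (2*n)) $$ (i, j)"
    using ij by (subst J_mat_mult_vec) (auto simp: J_mat_eq)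
  finally show "(J_mat n * J_mat n) $$ (i, j) = (- 1\<^sub>m (2*n)) $$ (i, j)" .
qed auto

text \<open>The coordinates \<open>l\<close> and \<open>n + l\<close> are conjugate. Together they
  form the mode \<open>l\<close>, and the form is a sum of one contribution from each mode.\<close>

lemma symplectic_form_eq:
  assumes "u \<in> carrier_vec (2*n)" "v \<in> carrier_vec (2*n)"
  shows "u \<bullet> (J_mat n *\<^sub>v v) = (\<Sum>l<n. u $ l * v $ (n + l) - u $ (n + l) * v $ l)"
proof -
  have "u \<bullet> (J_mat n *\<^sub>v v) = (\<Sum>i<2*n. u $ i * (if i < n then v $ (n + i) else - v $ (i - n)))"
    using assms by (auto simp: scalar_prod_def J_mat_mult_vec lessThan_atLeast0 intro!: sum.cong)
  then show ?thesis by (simp add: sum_double)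
qed

lemma symplectic_form_swap:
  assumes "u \<in> carrier_vec (2*n)" "v \<in> carrier_vec (2*n)"
  shows "v \<bullet> (J_mat n *\<^sub>v u) = - (u \<bullet> (J_mat n *\<^sub>v v))"
  using assms by (simp add: symplectic_form_eq sum_negf[symmetric] mult.commute)

lemma scalar_prod_J_J:
  assumes "u \<in> carrier_vec (2*n)" "v \<in> carrier_vec (2*n)"
  shows "(J_mat n *\<^sub>v u) \<bullet> (J_mat n *\<^sub>v v) = u \<bullet> v"
proof -
  have "(J_mat n *\<^sub>v u) \<bullet> (J_mat n *\<^sub>v v) = - (v \<bullet> (J_mat n *\<^sub>v (J_mat n *\<^sub>v u)))"
    by (rule symplectic_form_swap) (use assms mult_mat_vec_carrier[OF J_mat_carrier] in auto)
  also have "\<dots> = u \<bullet> v"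
    using assms by (simp add: comm_scalar_prod[of u "2*n" v])
  finally show ?thesis .
qed

text \<open>Translates between congruences of matrices and Gram matrices of columns. In particular,
  being symplectic is a statement about the pairings of the columns under
  \<open>J_mat n\<close>.\<close>

lemma index_congruence:
  fixes B :: "'a::comm_semiring_0 mat"
  assumes "M \<in> carrier_mat N m" "B \<in> carrier_mat N N" "i < m" "j < m"
  shows "(transpose_mat M * B * M) $$ (i, j) = col M i \<bullet> (B *\<^sub>v col M j)"
proof -
  have "transpose_mat M * B * M = transpose_mat M * (B * M)"
    using assms by (intro assoc_mult_mat) auto
  then show ?thesis
    using assms col_mult2[of B N N M m j] by (simp del: col_mult2)
qed

section \<open>The trace bound\<close>

lemma sum_half: "(\<Sum>i<2*k. f (i div 2)) = 2 * (\<Sum>j<k. f j)" for f :: "nat \<Rightarrow> real"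
  by (induction k) simp_all

text \<open>The right-hand side is a weighted sum of squared norms of the rows of the matrix
  \<open>S\<close> with columns \<open>s c\<close>. By Parseval these norms can be computed in any
  orthonormal basis of the 2k-dimensional space, so the basis may be adapted to the modes. Two such
  bases, \<open>w\<close> and its image under J, are averaged.\<close>

lemma symplectic_family_bound_diag:
  fixes s :: "nat \<Rightarrow> real vec" and d :: "nat \<Rightarrow> real"
  assumes k: "k \<le> n"
    and s: "\<And>c. c < 2*k \<Longrightarrow> s c \<in> carrier_vec (2*n)"
    and symp: "\<And>c c'. c < 2*k \<Longrightarrow> c' < 2*k \<Longrightarrow> s c \<bullet> (J_mat n *\<^sub>v s c') = J_mat k $$ (c, c')"
    and mono: "\<And>i j. i \<le> j \<Longrightarrow> j < n \<Longrightarrow> d i \<le> d j"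
    and nonneg: "\<And>i. i < n \<Longrightarrow> 0 \<le> d i"
  shows "2 * (\<Sum>j<k. d j) \<le> (\<Sum>c<2*k. \<Sum>l<n. d l * ((s c $ l)\<^sup>2 + (s c $ (n + l))\<^sup>2))"
proof -
  define S where "S = mat (2*n) (2*k) (\<lambda>(r, c). s c $ r)"
  have S: "S \<in> carrier_mat (2*n) (2*k)" by (simp add: S_def)
  have colS: "col S c = s c" if "c < 2*k" for c
    using that s[OF that] by (auto simp: S_def)
  have SJS: "transpose_mat S * J_mat n * S = J_mat k"
  proof (rule eq_matI)
    fix i j assume "i < dim_row (J_mat k)" "j < dim_col (J_mat k)"
    then show "(transpose_mat S * J_mat n * S) $$ (i, j) = J_mat k $$ (i, j)"
      using index_congruence[OF S J_mat_carrier] by (simp add: colS symp)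
  qed (use S in auto)
  define p where "p = row S"
  have p: "p l \<in> carrier_vec (2*k)" for l
    using S by (simp add: p_def row_def)
  \<comment> \<open>\<open>S\<close> preserves the symplectic form. Since the coordinates of
    \<open>S\<close> applied to \<open>u\<close> are the products \<open>p l \<bullet> u\<close>,
    this is the same fact written mode by mode.\<close>
  have form: "(\<Sum>l<n. (p l \<bullet> u) * (p (n + l) \<bullet> v) - (p (n + l) \<bullet> u) * (p l \<bullet> v)) = u \<bullet> (J_mat k *\<^sub>v v)"
    if u: "u \<in> carrier_vec (2*k)" and v: "v \<in> carrier_vec (2*k)" for u v
  proof -
    have Su: "S *\<^sub>v u \<in> carrier_vec (2*n)" and Sv: "S *\<^sub>v v \<in> carrier_vec (2*n)"
      using S u v by auto
    have JSv: "J_mat n *\<^sub>v (S *\<^sub>v v) \<in> carrier_vec (2*n)"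
      by (rule mult_mat_vec_carrier[OF J_mat_carrier Sv])
    have "(\<Sum>l<n. (p l \<bullet> u) * (p (n + l) \<bullet> v) - (p (n + l) \<bullet> u) * (p l \<bullet> v))
        = (S *\<^sub>v u) \<bullet> (J_mat n *\<^sub>v (S *\<^sub>v v))"
      unfolding symplectic_form_eq[OF Su Sv] using S by (auto simp: p_def intro!: sum.cong)
    also have "\<dots> = u \<bullet> (transpose_mat S *\<^sub>v (J_mat n *\<^sub>v (S *\<^sub>v v)))"
      using transpose_vec_mult_scalar[OF S u JSv] transpose_vec_mult_scalar[of "transpose_mat S" "2*k" "2*n" "J_mat n *\<^sub>v (S *\<^sub>v v)" u]
        S u JSv by simp
    also have "transpose_mat S *\<^sub>v (J_mat n *\<^sub>v (S *\<^sub>v v)) = (transpose_mat S * J_mat n * S) *\<^sub>v v"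
      using S v Sv by (simp add: assoc_mult_mat_vec[of _ "2*k" "2*n" _ "2*k"]
          assoc_mult_mat_vec[of "transpose_mat S" "2*k" "2*n" "J_mat n" "2*n"])
    finally show ?thesis by (simp add: SJS)
  qed
  \<comment> \<open>Both coordinates of a mode are adjacent, so \<open>w i\<close> kills all modes below \<open>i div 2\<close>.\<close>
  define r where "r j = p (if even j then j div 2 else n + j div 2)" for j
  obtain w where w: "\<And>i. i < 2*k \<Longrightarrow> w i \<in> carrier_vec (2*k)"
    and orth: "\<And>i j. i < 2*k \<Longrightarrow> j < 2*k \<Longrightarrow> w i \<bullet> w j = (if i = j then 1 else 0)"
    and tri: "\<And>i j. i < 2*k \<Longrightarrow> j < i \<Longrightarrow> r j \<bullet> w i = 0"
    using triangularizing_orthonormal_basis[of "2*k" r] p by (metis r_def)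
  \<comment> \<open>The partner of \<open>w i\<close>: as J is orthogonal, these vectors are
    orthonormal again, and the symplectic pairing of \<open>w i\<close> with its partner is
    -1.\<close>
  define w' where "w' i = J_mat k *\<^sub>v w i" for i
  have w': "w' i \<in> carrier_vec (2*k)" if "i < 2*k" for i
    unfolding w'_def by (rule mult_mat_vec_carrier[OF J_mat_carrier w[OF that]])
  have orth': "w' i \<bullet> w' j = (if i = j then 1 else 0)" if "i < 2*k" "j < 2*k" for i j
    using that by (simp add: w'_def scalar_prod_J_J w orth)
  define q where "q v l = (p l \<bullet> v)\<^sup>2 + (p (n + l) \<bullet> v)\<^sup>2" for v l
  have step: "d (i div 2) \<le> (\<Sum>l<n. d l * ((q (w i) l + q (w' i) l) / 2))" if i: "i < 2*k" for i
  proof -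
    \<comment> \<open>Minus the contribution of mode \<open>l\<close> to the pairing of
      \<open>w i\<close> and \<open>w' i\<close>, so that the total is 1.\<close>
    define t where "t l = (p (n + l) \<bullet> w i) * (p l \<bullet> w' i) - (p l \<bullet> w i) * (p (n + l) \<bullet> w' i)" for l
    have m: "i div 2 < n" using i k by linarith
    have "w i \<bullet> (J_mat k *\<^sub>v w' i) = -1"
      using w[OF i] orth[OF i i] by (simp add: w'_def)
    then have "(\<Sum>l<n. t l) = 1"
      using form[OF w[OF i] w'[OF i]] unfolding t_def
      by (metis (no_types, lifting) minus_diff_eq minus_minus sum.cong sum_negf)
    then have "d (i div 2) = (\<Sum>l<n. d (i div 2) * t l)"
      by (simp add: sum_distrib_left[symmetric])
    also have "\<dots> \<le> (\<Sum>l<n. d l * ((q (w i) l + q (w' i) l) / 2))"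
    proof (rule sum_mono)
      fix l assume "l \<in> {..<n}"
      then have l: "l < n" by simp
      have q0: "0 \<le> (q (w i) l + q (w' i) l) / 2" by (simp add: q_def)
      show "d (i div 2) * t l \<le> d l * ((q (w i) l + q (w' i) l) / 2)"
      proof (cases "l < i div 2")
        case True
        then have "r (2*l) \<bullet> w i = 0" "r (2*l+1) \<bullet> w i = 0"
          using i by (auto intro!: tri)
        then have "t l = 0" by (simp add: r_def t_def)
        then show ?thesis using q0 nonneg[OF l] by simp
      next
        case False
        \<comment> \<open>The arithmetic-geometric mean inequality for each of the two products in
          \<open>t l\<close>. For the remaining modes \<open>d (i div 2)\<close> can then be
          enlarged to \<open>d l\<close>, because the factor next to it is nonnegative.\<close>
        have "t l \<le> (q (w i) l + q (w' i) l) / 2"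
          using sum_squares_bound[of "p (n + l) \<bullet> w i" "p l \<bullet> w' i"]
            zero_le_power2[of "(p l \<bullet> w i) + (p (n + l) \<bullet> w' i)"]
          by (simp add: t_def q_def power2_sum)
        then show ?thesis
          using False mono[of "i div 2" l] nonneg[OF m] l q0
          by (meson mult_left_mono mult_right_mono not_less order_trans)
      qed
    qed
    finally show ?thesis .
  qed
  \<comment> \<open>Summed over the basis, the energy of mode \<open>l\<close> is the squared norm
    of its two rows, whichever of the two bases is used.\<close>
  have par: "(\<Sum>i<2*k. q (w i) l) = p l \<bullet> p l + p (n + l) \<bullet> p (n + l)"
    "(\<Sum>i<2*k. q (w' i) l) = p l \<bullet> p l + p (n + l) \<bullet> p (n + l)" for l
    using parseval[of "2*k" w, OF w orth p] parseval[of "2*k" w', OF w' orth' p]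
    by (simp_all add: q_def sum.distrib)
  have pp: "p l \<bullet> p l = (\<Sum>c<2*k. (s c $ l)\<^sup>2)" if "l < 2*n" for l
    using that by (auto simp: p_def S_def scalar_prod_def power2_eq_square lessThan_atLeast0)
  have "2 * (\<Sum>j<k. d j) = (\<Sum>i<2*k. d (i div 2))" by (simp add: sum_half)
  also have "\<dots> \<le> (\<Sum>i<2*k. \<Sum>l<n. d l * ((q (w i) l + q (w' i) l) / 2))"
    by (intro sum_mono step) simp
  also have "\<dots> = (\<Sum>l<n. \<Sum>i<2*k. d l * ((q (w i) l + q (w' i) l) / 2))"
    by (rule sum.swap)
  also have "\<dots> = (\<Sum>l<n. d l * (((\<Sum>i<2*k. q (w i) l) + (\<Sum>i<2*k. q (w' i) l)) / 2))"
    by (simp add: sum_distrib_left sum_divide_distrib sum.distrib add_divide_distrib distrib_left)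
  also have "\<dots> = (\<Sum>l<n. d l * (\<Sum>c<2*k. (s c $ l)\<^sup>2 + (s c $ (n + l))\<^sup>2))"
    by (auto simp: par pp sum.distrib intro!: sum.cong)
  also have "\<dots> = (\<Sum>l<n. \<Sum>c<2*k. d l * ((s c $ l)\<^sup>2 + (s c $ (n + l))\<^sup>2))"
    by (simp add: sum_distrib_left)
  also have "\<dots> = (\<Sum>c<2*k. \<Sum>l<n. d l * ((s c $ l)\<^sup>2 + (s c $ (n + l))\<^sup>2))"
    by (rule sum.swap)
  finally show ?thesis .
qed

section \<open>From the diagonal model to a general matrix\<close>

lemma symplectic_mat_inverse:
  assumes "symplectic_mat n M"
  obtains Q where "Q \<in> carrier_mat (2*n) (2*n)" "M * Q = 1\<^sub>m (2*n)"
proof -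
  have M: "M \<in> carrier_mat (2*n) (2*n)" and MJM: "transpose_mat M * J_mat n * M = J_mat n"
    using assms by (auto simp: symplectic_mat_def)
  \<comment> \<open>Multiplying \<open>transpose_mat M * J_mat n * M = J_mat n\<close> from the left
    by J, whose square is -1, shows that this is a left inverse of \<open>M\<close>. For square
    matrices it is then a right inverse too.\<close>
  define Q where "Q = - (J_mat n * (transpose_mat M * J_mat n))"
  have Q: "Q \<in> carrier_mat (2*n) (2*n)" using M by (auto simp: Q_def)
  have "Q * M = - (J_mat n * (transpose_mat M * J_mat n) * M)"
    using M by (simp add: Q_def)
  also have "J_mat n * (transpose_mat M * J_mat n) * M = J_mat n * (transpose_mat M * J_mat n * M)"
    using M by (intro assoc_mult_mat) auto
  also have "- \<dots> = 1\<^sub>m (2*n)"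
    by (simp add: MJM J_mat_sq)
  finally show ?thesis
    using that[OF Q] mat_mult_left_right_inverse[OF Q M] by simp
qed

text \<open>The matrix D (+) D, with the diagonal of D given as a function, which makes it easy to
  reorder.\<close>

abbreviation double_diag :: "nat \<Rightarrow> (nat \<Rightarrow> real) \<Rightarrow> real mat" where
  "double_diag n d \<equiv> mat (2*n) (2*n) (\<lambda>(i, j). if i = j then d (if i < n then i else i - n) else 0)"

text \<open>In the coordinates given by the inverse of \<open>M\<close>, the family keeps its
  symplectic Gram matrix while the quadratic form of \<open>A\<close> becomes diagonal.\<close>

lemma symplectic_family_bound:
  fixes s :: "nat \<Rightarrow> real vec" and d :: "nat \<Rightarrow> real"
  assumes A: "A \<in> carrier_mat (2*n) (2*n)"
    and M: "symplectic_mat n M" and MAM: "transpose_mat M * A * M = double_diag n d"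
    and k: "k \<le> n"
    and s: "\<And>c. c < 2*k \<Longrightarrow> s c \<in> carrier_vec (2*n)"
    and symp: "\<And>c c'. c < 2*k \<Longrightarrow> c' < 2*k \<Longrightarrow> s c \<bullet> (J_mat n *\<^sub>v s c') = J_mat k $$ (c, c')"
    and mono: "\<And>i j. i \<le> j \<Longrightarrow> j < n \<Longrightarrow> d i \<le> d j"
    and nonneg: "\<And>i. i < n \<Longrightarrow> 0 \<le> d i"
  shows "2 * (\<Sum>j<k. d j) \<le> (\<Sum>c<2*k. s c \<bullet> (A *\<^sub>v s c))"
proof -
  have Mc: "M \<in> carrier_mat (2*n) (2*n)" and MJM: "transpose_mat M * J_mat n * M = J_mat n"
    using M by (auto simp: symplectic_mat_def)
  obtain Q where Q: "Q \<in> carrier_mat (2*n) (2*n)" and MQ: "M * Q = 1\<^sub>m (2*n)"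
    by (rule symplectic_mat_inverse[OF M])
  define t where "t c = Q *\<^sub>v s c" for c
  have t: "t c \<in> carrier_vec (2*n)" if "c < 2*k" for c
    using Q s[OF that] by (auto simp: t_def)
  have st: "s c = M *\<^sub>v t c" if "c < 2*k" for c
    using assoc_mult_mat_vec[OF Mc Q s[OF that]] s[OF that] by (simp add: MQ t_def)
  \<comment> \<open>Used twice: with \<open>A\<close> for the quadratic form and with
    \<open>J_mat n\<close> for the symplectic pairings.\<close>
  have cong: "(M *\<^sub>v u) \<bullet> (B *\<^sub>v (M *\<^sub>v v)) = u \<bullet> ((transpose_mat M * B * M) *\<^sub>v v)"
    if u: "u \<in> carrier_vec (2*n)" and v: "v \<in> carrier_vec (2*n)" and B: "B \<in> carrier_mat (2*n) (2*n)"
    for u v B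
  proof -
    have Mv: "M *\<^sub>v v \<in> carrier_vec (2*n)" and MB: "transpose_mat M * B \<in> carrier_mat (2*n) (2*n)"
      using Mc B v by auto
    have "(transpose_mat M * B * M) *\<^sub>v v = transpose_mat M *\<^sub>v (B *\<^sub>v (M *\<^sub>v v))"
      using assoc_mult_mat_vec[OF MB Mc v] assoc_mult_mat_vec[of "transpose_mat M" "2*n" "2*n" B "2*n" "M *\<^sub>v v"]
        Mc B Mv by simp
    then show ?thesis
      using transpose_vec_mult_scalar[of "transpose_mat M" "2*n" "2*n" "B *\<^sub>v (M *\<^sub>v v)" u] Mc B Mv u
        mult_mat_vec_carrier[OF B Mv] by simp
  qed
  have "s c \<bullet> (A *\<^sub>v s c) = (\<Sum>l<n. d l * ((t c $ l)\<^sup>2 + (t c $ (n + l))\<^sup>2))" if c: "c < 2*k" for c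
  proof -
    have ent: "(double_diag n d *\<^sub>v t c) $ i = d (if i < n then i else i - n) * t c $ i" if i: "i < 2*n" for i
    proof -
      have "(double_diag n d *\<^sub>v t c) $ i = row (double_diag n d) i \<bullet> t c"
        by (rule index_mult_mat_vec) (use i in simp)
      also have "\<dots> = (\<Sum>j\<in>{0..<2*n}. if j = i then d (if i < n then i else i - n) * t c $ i else 0)"
        unfolding scalar_prod_def carrier_vecD[OF t[OF c]]
        by (rule sum.cong) (use i in auto)
      also have "\<dots> = d (if i < n then i else i - n) * t c $ i"
        using i by (subst sum.delta) auto
      finally show ?thesis .
    qed
    have "s c \<bullet> (A *\<^sub>v s c) = t c \<bullet> (double_diag n d *\<^sub>v t c)"
      using cong[OF t[OF c] t[OF c] A] st[OF c] MAM by simp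
    also have "\<dots> = (\<Sum>i<2*n. d (if i < n then i else i - n) * (t c $ i)\<^sup>2)"
      unfolding scalar_prod_def
      by (rule sum.cong) (auto simp: ent power2_eq_square lessThan_atLeast0 simp del: index_mult_mat_vec)
    also have "\<dots> = (\<Sum>l<n. d l * ((t c $ l)\<^sup>2 + (t c $ (n + l))\<^sup>2))"
      by (simp add: sum_double distrib_left)
    finally show ?thesis .
  qed
  moreover have "2 * (\<Sum>j<k. d j) \<le> (\<Sum>c<2*k. \<Sum>l<n. d l * ((t c $ l)\<^sup>2 + (t c $ (n + l))\<^sup>2))"
  proof (rule symplectic_family_bound_diag[OF k t])
    fix c c' assume c: "c < 2*k" "c' < 2*k"
    show "t c \<bullet> (J_mat n *\<^sub>v t c') = J_mat k $$ (c, c')"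
      using cong[OF t t J_mat_carrier, OF c] symp[OF c] MJM st c by simp
  qed (use mono nonneg in auto)
  ultimately show ?thesis by simp
qed

section \<open>Eigenvectors in invariant subspaces\<close>

text \<open>This is p(M) v, evaluated by Horner's scheme on vectors. No powers of \<open>M\<close>
  are formed, so properties of the result follow by induction on the coefficients.\<close>

definition poly_mat_vec :: "'a::comm_ring_1 mat \<Rightarrow> 'a vec \<Rightarrow> 'a poly \<Rightarrow> 'a vec" where
  "poly_mat_vec M v p = fold_coeffs (\<lambda>a u. a \<cdot>\<^sub>v v + M *\<^sub>v u) p (0\<^sub>v (dim_vec v))"

lemma smult_vec_zero: "a \<cdot>\<^sub>v 0\<^sub>v n = (0\<^sub>v n :: 'a::mult_zero vec)"
  by (rule eq_vecI) auto

context
  fixes M :: "'a::field mat" and v :: "'a vec" and N :: nat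
  assumes M: "M \<in> carrier_mat N N" and v: "v \<in> carrier_vec N"
begin

lemma poly_mat_vec_0: "poly_mat_vec M v 0 = 0\<^sub>v N"
  using v by (simp add: poly_mat_vec_def)

lemma poly_mat_vec_pCons: "poly_mat_vec M v (pCons a p) = a \<cdot>\<^sub>v v + M *\<^sub>v poly_mat_vec M v p"
proof (cases "a = 0 \<and> p = 0")
  \<comment> \<open>Here \<open>pCons a p\<close> is the zero polynomial, which has no coefficients
    to fold over; the equation reduces to M 0 = 0.\<close>
  case True
  have "M *\<^sub>v 0\<^sub>v N = 0\<^sub>v N" using M by (intro eq_vecI) auto
  moreover have "0 \<cdot>\<^sub>v v = 0\<^sub>v N" using v by (intro eq_vecI) auto
  ultimately show ?thesis using True by (simp add: poly_mat_vec_0)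
next
  case False
  then show ?thesis by (auto simp: poly_mat_vec_def)
qed

lemma poly_mat_vec_in_subspace:
  assumes "v \<in> V" "0\<^sub>v N \<in> V" "\<And>u w. u \<in> V \<Longrightarrow> w \<in> V \<Longrightarrow> u + w \<in> V"
    "\<And>a u. u \<in> V \<Longrightarrow> a \<cdot>\<^sub>v u \<in> V" "\<And>u. u \<in> V \<Longrightarrow> M *\<^sub>v u \<in> V"
  shows "poly_mat_vec M v p \<in> V"
  by (induction p) (simp_all add: poly_mat_vec_0 poly_mat_vec_pCons assms)

lemma poly_mat_vec_carrier: "poly_mat_vec M v p \<in> carrier_vec N"
  by (rule poly_mat_vec_in_subspace) (use M v in auto)

lemma poly_mat_vec_add:
  "poly_mat_vec M v (p + q) = poly_mat_vec M v p + poly_mat_vec M v q"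
proof (induction p q rule: poly_induct2)
  case 0
  show ?case by (simp add: poly_mat_vec_0)
next
  case (pCons a p b q)
  note c = poly_mat_vec_carrier
  have "poly_mat_vec M v (pCons a p + pCons b q) =
      (a + b) \<cdot>\<^sub>v v + (M *\<^sub>v poly_mat_vec M v p + M *\<^sub>v poly_mat_vec M v q)"
    using mult_add_distrib_mat_vec[OF M c c] by (simp add: poly_mat_vec_pCons pCons.IH)
  also have "\<dots> = poly_mat_vec M v (pCons a p) + poly_mat_vec M v (pCons b q)"
    using M v by (intro eq_vecI) (auto simp: poly_mat_vec_pCons algebra_simps)
  finally show ?case .
qed

lemma poly_mat_vec_smult: "poly_mat_vec M v (smult a p) = a \<cdot>\<^sub>v poly_mat_vec M v p"
proof (induction p)
  case 0
  show ?case by (simp add: poly_mat_vec_0 smult_vec_zero)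
next
  case (pCons b p)
  then show ?case
    using M v mult_mat_vec[OF M poly_mat_vec_carrier, of a p]
    by (intro eq_vecI) (auto simp: poly_mat_vec_pCons algebra_simps)
qed

lemma poly_mat_vec_linear_factor:
  "poly_mat_vec M v ([:- l, 1:] * q) = M *\<^sub>v poly_mat_vec M v q + (- l) \<cdot>\<^sub>v poly_mat_vec M v q"
proof -
  have "[:- l, 1:] * q = pCons 0 q + smult (- l) q"
    by (simp add: mult_pCons_left)
  moreover have "0 \<cdot>\<^sub>v v = 0\<^sub>v N" using v by (intro eq_vecI) auto
  ultimately show ?thesis
    using mult_mat_vec_carrier[OF M poly_mat_vec_carrier[of q]]
    by (simp only: poly_mat_vec_add poly_mat_vec_smult poly_mat_vec_pCons) simp
qed

text \<open>Expands p(M) v in the Krylov vectors v, M v, M^2 v, and so on. Pairing with a vector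
  \<open>g\<close> turns this into a sum of scalars; in the induction one factor \<open>M\<close> is
  moved onto \<open>g\<close> as its transpose.\<close>

lemma scalar_prod_poly_mat_vec:
  "g \<in> carrier_vec N \<Longrightarrow>
    g \<bullet> poly_mat_vec M v (Poly xs) = (\<Sum>j<length xs. xs ! j * (g \<bullet> (((*\<^sub>v) M) ^^ j) v))"
proof (induction xs arbitrary: g)
  case Nil
  then show ?case by (simp add: poly_mat_vec_0)
next
  case (Cons a xs)
  have K: "(((*\<^sub>v) M) ^^ j) v \<in> carrier_vec N" for j
    by (induction j) (use M v in auto)
  have T: "(transpose_mat M *\<^sub>v g) \<bullet> u = g \<bullet> (M *\<^sub>v u)" if "u \<in> carrier_vec N" for u
    using transpose_vec_mult_scalar[OF M that Cons.prems] .
  have g': "transpose_mat M *\<^sub>v g \<in> carrier_vec N" using M Cons.prems by auto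
  have "g \<bullet> poly_mat_vec M v (Poly (a # xs)) =
      a * (g \<bullet> v) + g \<bullet> (M *\<^sub>v poly_mat_vec M v (Poly xs))"
    using M v Cons.prems poly_mat_vec_carrier
    by (simp add: poly_mat_vec_pCons scalar_prod_add_distrib[of _ N])
  also have "g \<bullet> (M *\<^sub>v poly_mat_vec M v (Poly xs)) =
      (\<Sum>j<length xs. xs ! j * (g \<bullet> (((*\<^sub>v) M) ^^ Suc j) v))"
    using Cons.IH[OF g'] by (simp add: T[OF poly_mat_vec_carrier] T[OF K])
  finally show ?case
    by (simp add: sum.lessThan_Suc_shift del: funpow.simps sum.lessThan_Suc)
qed

text \<open>The N + 1 Krylov vectors up to M^N v are linearly dependent in dimension N; a dependence
  supplies the coefficients.\<close>

lemma annihilating_poly_exists: "\<exists>p. p \<noteq> 0 \<and> poly_mat_vec M v p = 0\<^sub>v N"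
proof -
  define K where "K j = (((*\<^sub>v) M) ^^ j) v" for j
  have K: "K j \<in> carrier_vec N" for j
    unfolding K_def by (induction j) (use M v in auto)
  \<comment> \<open>One equation per coordinate \<open>r\<close>, with the N + 1 coefficients as
    unknowns.\<close>
  obtain c where c: "c \<in> carrier_vec (Suc N)" "c \<noteq> 0\<^sub>v (Suc N)"
      "\<And>r. r < N \<Longrightarrow> vec (Suc N) (\<lambda>j. K j $ r) \<bullet> c = 0"
    using homogeneous_system_nontrivial[of N "Suc N" "\<lambda>r. vec (Suc N) (\<lambda>j. K j $ r)"] by auto
  define xs where "xs = list_of_vec c"
  have xs: "length xs = Suc N" "\<And>j. j < Suc N \<Longrightarrow> xs ! j = c $ j"
    using c(1) by (auto simp: xs_def list_of_vec_index)
  obtain j where j: "j < Suc N" "c $ j \<noteq> 0"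
    using c(1,2) by (metis carrier_vecD eq_vecI index_zero_vec)
  then have "coeff (Poly xs) j \<noteq> coeff 0 j" using xs by (simp add: nth_default_def)
  then have "Poly xs \<noteq> 0" by metis
  moreover have "poly_mat_vec M v (Poly xs) = 0\<^sub>v N"
  proof (rule eq_vecI)
    fix r assume "r < dim_vec (0\<^sub>v N :: 'a vec)"
    then have r: "r < N" by simp
    have "poly_mat_vec M v (Poly xs) $ r = unit_vec N r \<bullet> poly_mat_vec M v (Poly xs)"
      using r poly_mat_vec_carrier by simp
    also have "\<dots> = (\<Sum>j<Suc N. c $ j * K j $ r)"
      using scalar_prod_poly_mat_vec[of "unit_vec N r" xs] r K xs by (simp add: K_def)
    also have "\<dots> = vec (Suc N) (\<lambda>j. K j $ r) \<bullet> c"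
      using c(1) by (auto simp: scalar_prod_def lessThan_atLeast0 mult.commute intro!: sum.cong)
    finally show "poly_mat_vec M v (Poly xs) $ r = 0\<^sub>v N $ r" using c(3) r by simp
  qed (use poly_mat_vec_carrier in simp)
  ultimately show ?thesis by blast
qed

end

text \<open>Split a linear factor X - l off a polynomial annihilating \<open>v\<close>, leaving q.
  Either q already annihilates \<open>v\<close> and has smaller degree, or q(M) v is an eigenvector
  for l. It lies in \<open>V\<close> because \<open>V\<close> is invariant.\<close>

lemma eigenvector_in_invariant_subspace:
  fixes M :: "complex mat"
  assumes M: "M \<in> carrier_mat N N" and V: "V \<subseteq> carrier_vec N"
    and add: "\<And>u w. u \<in> V \<Longrightarrow> w \<in> V \<Longrightarrow> u + w \<in> V"
    and smult: "\<And>a u. u \<in> V \<Longrightarrow> a \<cdot>\<^sub>v u \<in> V"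
    and inv: "\<And>u. u \<in> V \<Longrightarrow> M *\<^sub>v u \<in> V"
    and v: "v \<in> V" "v \<noteq> 0\<^sub>v N"
  obtains z l where "z \<in> V" "z \<noteq> 0\<^sub>v N" "M *\<^sub>v z = l \<cdot>\<^sub>v z"
proof -
  have vc: "v \<in> carrier_vec N" using V v by auto
  have z: "0\<^sub>v N \<in> V" using smult[OF v(1), of 0] vc
    by (metis carrier_vecD eq_vecI index_smult_vec index_zero_vec mult_zero_left)
  have inV: "poly_mat_vec M v p \<in> V" for p
    by (rule poly_mat_vec_in_subspace[OF M vc]) (use v z add smult inv in auto)
  have "\<exists>z\<in>V. \<exists>l. z \<noteq> 0\<^sub>v N \<and> M *\<^sub>v z = l \<cdot>\<^sub>v z"
    if "p \<noteq> 0" "poly_mat_vec M v p = 0\<^sub>v N" for p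
    using that
  proof (induction "degree p" arbitrary: p rule: less_induct)
    case less
    have "degree p \<noteq> 0"
    \<comment> \<open>A nonzero constant cannot annihilate the nonzero vector
      \<open>v\<close>.\<close>
    proof
      assume "degree p = 0"
      then obtain a where p: "p = [:a:]" by (auto elim: degree_eq_zeroE)
      have "M *\<^sub>v 0\<^sub>v N = 0\<^sub>v N" using M by (intro eq_vecI) auto
      then have "a \<cdot>\<^sub>v v = 0\<^sub>v N"
        using less.prems vc by (simp add: p poly_mat_vec_pCons[OF M vc] poly_mat_vec_0[OF M vc])
      moreover have "a \<noteq> 0" using less.prems p by auto
      ultimately have "v = 0\<^sub>v N"
        using vc by (metis left_inverse one_smult_vec smult_smult_assoc smult_vec_zero)
      then show False using v by simp
    qed
    then obtain l where "poly p l = 0"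
      using fundamental_theorem_of_algebra[of p] by (auto simp: constant_degree)
    then obtain q where p: "p = [:- l, 1:] * q"
      by (auto simp: poly_eq_0_iff_dvd)
    have q: "q \<noteq> 0" using less.prems p by auto
    have deg: "degree q < degree p"
      unfolding p using q by (subst degree_mult_eq) auto
    show ?case
    proof (cases "poly_mat_vec M v q = 0\<^sub>v N")
      case True
      then show ?thesis using less.hyps[OF deg q] by blast
    next
      case False
      define u where "u = poly_mat_vec M v q"
      have u: "u \<in> carrier_vec N" "M *\<^sub>v u \<in> carrier_vec N"
        using V inV inv by (auto simp: u_def)
      have e: "M *\<^sub>v u + (- l) \<cdot>\<^sub>v u = 0\<^sub>v N"
        using less.prems(2) unfolding p poly_mat_vec_linear_factor[OF M vc] u_def .
      have "M *\<^sub>v u = l \<cdot>\<^sub>v u"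
      proof (rule eq_vecI)
        fix i assume i: "i < dim_vec (l \<cdot>\<^sub>v u)"
        have "(M *\<^sub>v u + (- l) \<cdot>\<^sub>v u) $ i = 0" unfolding e using u i by simp
        then show "(M *\<^sub>v u) $ i = (l \<cdot>\<^sub>v u) $ i" using u i M by (simp del: index_mult_mat_vec)
      qed (use u M in auto)
      then show ?thesis using False inV by (auto simp: u_def)
    qed
  qed
  then show ?thesis using that annihilating_poly_exists[OF M vc] by blast
qed

text \<open>Complexify: \<open>x\<close> and \<open>y\<close> are the real and imaginary parts of a
  complex eigenvector in the complexification of \<open>V\<close>, and its eigenvalue is a +
  ib.\<close>

lemma eigenplane_in_invariant_subspace:
  fixes M :: "real mat"
  assumes M: "M \<in> carrier_mat N N" and V: "V \<subseteq> carrier_vec N"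
    and add: "\<And>u w. u \<in> V \<Longrightarrow> w \<in> V \<Longrightarrow> u + w \<in> V"
    and smult: "\<And>a u. u \<in> V \<Longrightarrow> a \<cdot>\<^sub>v u \<in> V"
    and inv: "\<And>u. u \<in> V \<Longrightarrow> M *\<^sub>v u \<in> V"
    and v: "v \<in> V" "v \<noteq> 0\<^sub>v N"
  obtains x y a b where "x \<in> V" "y \<in> V" "x \<noteq> 0\<^sub>v N \<or> y \<noteq> 0\<^sub>v N"
    "M *\<^sub>v x = a \<cdot>\<^sub>v x + (- b) \<cdot>\<^sub>v y" "M *\<^sub>v y = b \<cdot>\<^sub>v x + a \<cdot>\<^sub>v y"
proof -
  define MC where "MC = map_mat complex_of_real M"
  have MC: "MC \<in> carrier_mat N N" using M by (simp add: MC_def)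
  \<comment> \<open>The complexification of \<open>V\<close>.\<close>
  define VC where "VC = {z \<in> carrier_vec N. map_vec Re z \<in> V \<and> map_vec Im z \<in> V}"
  have Re_M: "map_vec Re (MC *\<^sub>v z) = M *\<^sub>v map_vec Re z"
    and Im_M: "map_vec Im (MC *\<^sub>v z) = M *\<^sub>v map_vec Im z" if "z \<in> carrier_vec N" for z
    using that M by (auto intro!: eq_vecI sum.cong simp: MC_def scalar_prod_def)
  have Re_s: "map_vec Re (c \<cdot>\<^sub>v z) = Re c \<cdot>\<^sub>v map_vec Re z + (- Im c) \<cdot>\<^sub>v map_vec Im z"
    and Im_s: "map_vec Im (c \<cdot>\<^sub>v z) = Im c \<cdot>\<^sub>v map_vec Re z + Re c \<cdot>\<^sub>v map_vec Im z" for c z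
    by auto
  have Re_a: "map_vec Re (z + z') = map_vec Re z + map_vec Re z'"
    and Im_a: "map_vec Im (z + z') = map_vec Im z + map_vec Im z'"
    if "z \<in> carrier_vec N" "z' \<in> carrier_vec N" for z z' :: "complex vec"
    using that by auto
  have vc: "v \<in> carrier_vec N" using v V by auto
  have z0: "0\<^sub>v N \<in> V" using smult[OF v(1), of 0] vc
    by (metis carrier_vecD eq_vecI index_smult_vec index_zero_vec mult_zero_left)
  obtain z c where z: "z \<in> VC" "z \<noteq> 0\<^sub>v N" "MC *\<^sub>v z = c \<cdot>\<^sub>v z"
  proof (rule eigenvector_in_invariant_subspace[OF MC, of VC "map_vec complex_of_real v"])
    show "MC *\<^sub>v u \<in> VC" if "u \<in> VC" for u
      using that inv MC by (auto simp: VC_def Re_M Im_M)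
    have "map_vec Re (map_vec complex_of_real v) = v" "map_vec Im (map_vec complex_of_real v) = 0\<^sub>v N"
      using vc by auto
    then show "map_vec complex_of_real v \<in> VC"
      using v z0 vc by (simp add: VC_def)
    obtain i where "i < N" "v $ i \<noteq> 0"
      using v(2) vc by (metis carrier_vecD eq_vecI index_zero_vec)
    then show "map_vec complex_of_real v \<noteq> 0\<^sub>v N"
      using vc by (metis carrier_vecD index_map_vec(1) index_zero_vec(1) of_real_eq_0_iff)
  qed (use add smult in \<open>auto simp: VC_def Re_s Im_s Re_a Im_a\<close>)
  have zc: "z \<in> carrier_vec N" using z by (simp add: VC_def)
  show ?thesis
  proof (rule that[of "map_vec Re z" "map_vec Im z" "Re c" "Im c"])
    show "map_vec Re z \<noteq> 0\<^sub>v N \<or> map_vec Im z \<noteq> 0\<^sub>v N"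
    proof (rule ccontr)
      assume "\<not> ?thesis"
      then have 0: "map_vec Re z = 0\<^sub>v N" "map_vec Im z = 0\<^sub>v N" by auto
      have "z = 0\<^sub>v N"
      proof (rule eq_vecI)
        fix i assume i: "i < dim_vec (0\<^sub>v N :: complex vec)"
        have "map_vec Re z $ i = 0" "map_vec Im z $ i = 0" unfolding 0 using i by auto
        then show "z $ i = 0\<^sub>v N $ i" using i zc by (simp add: complex_eq_iff)
      qed (use zc in simp)
      then show False using z by simp
    qed
  qed (use z Re_M[OF zc] Im_M[OF zc] in \<open>auto simp: VC_def Re_s Im_s\<close>)
qed

section \<open>Williamson's theorem\<close>

lemma positive_definite_form_swap:
  assumes "positive_definite A" "A \<in> carrier_mat N N" "u \<in> carrier_vec N" "v \<in> carrier_vec N"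
  shows "u \<bullet> (A *\<^sub>v v) = v \<bullet> (A *\<^sub>v u)"
proof -
  have "transpose_mat A = A" using assms(1) by (simp add: positive_definite_def)
  then show ?thesis
    using transpose_vec_mult_scalar[OF assms(2,4,3)] assms
    by (simp add: comm_scalar_prod[of "A *\<^sub>v u" N v])
qed

lemma positive_definite_form_pos:
  assumes "positive_definite A" "A \<in> carrier_mat N N" "v \<in> carrier_vec N" "v \<noteq> 0\<^sub>v N"
  shows "0 < v \<bullet> (A *\<^sub>v v)"
  using assms by (auto simp: positive_definite_def)

lemma symplectic_form_self:
  assumes "u \<in> carrier_vec (2*n)"
  shows "u \<bullet> (J_mat n *\<^sub>v u) = 0"
  using symplectic_form_swap[OF assms assms] by simp

text \<open>The common kernel of the \<open>g j\<close> is nontrivial since \<open>m < 2*n\<close>,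
  and \<open>inv\<close> says that J A maps it to itself. Hence it contains an eigenplane of J A.
  Skewness forces the real part of the eigenvalue to vanish, and rescaling makes the symplectic
  pairing equal to 1.\<close>

lemma symplectic_eigenpair:
  assumes pd: "positive_definite A" and A: "A \<in> carrier_mat (2*n) (2*n)"
    and m: "m < 2*n" and g: "\<And>j. j < m \<Longrightarrow> g j \<in> carrier_vec (2*n)"
    and inv: "\<And>u j. u \<in> carrier_vec (2*n) \<Longrightarrow> \<forall>j<m. g j \<bullet> u = 0 \<Longrightarrow> j < m \<Longrightarrow>
      g j \<bullet> (J_mat n *\<^sub>v (A *\<^sub>v u)) = 0"
  shows "\<exists>x y d. x \<in> carrier_vec (2*n) \<and> y \<in> carrier_vec (2*n) \<and> 0 < d \<and>
    A *\<^sub>v x = d \<cdot>\<^sub>v (J_mat n *\<^sub>v y) \<and> A *\<^sub>v y = (- d) \<cdot>\<^sub>v (J_mat n *\<^sub>v x) \<and>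
    x \<bullet> (J_mat n *\<^sub>v y) = 1 \<and> (\<forall>j<m. g j \<bullet> x = 0) \<and> (\<forall>j<m. g j \<bullet> y = 0)"
proof -
  define V where "V = {u \<in> carrier_vec (2*n). \<forall>j<m. g j \<bullet> u = 0}"
  let ?J = "J_mat n"
  have J: "?J *\<^sub>v u \<in> carrier_vec (2*n)" if "u \<in> carrier_vec (2*n)" for u
    by (rule mult_mat_vec_carrier[OF J_mat_carrier that])
  have Ac: "A *\<^sub>v u \<in> carrier_vec (2*n)" if "u \<in> carrier_vec (2*n)" for u
    by (rule mult_mat_vec_carrier[OF A that])
  have JA: "(?J * A) *\<^sub>v u = ?J *\<^sub>v (A *\<^sub>v u)" if "u \<in> carrier_vec (2*n)" for u
    by (rule assoc_mult_mat_vec[OF J_mat_carrier A that])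
  obtain v where v: "v \<in> V" "v \<noteq> 0\<^sub>v (2*n)"
    using homogeneous_system_nontrivial[of m "2*n" g] m g by (auto simp: V_def)
  obtain x y a b where x: "x \<in> V" and y: "y \<in> V" and nz: "x \<noteq> 0\<^sub>v (2*n) \<or> y \<noteq> 0\<^sub>v (2*n)"
    and Mx: "(?J * A) *\<^sub>v x = a \<cdot>\<^sub>v x + (- b) \<cdot>\<^sub>v y" and My: "(?J * A) *\<^sub>v y = b \<cdot>\<^sub>v x + a \<cdot>\<^sub>v y"
  proof (rule eigenplane_in_invariant_subspace[of "?J * A" "2*n" V v])
    show "?J * A \<in> carrier_mat (2*n) (2*n)" using A by auto
    show "(?J * A) *\<^sub>v u \<in> V" if "u \<in> V" for u
      using that inv J Ac by (auto simp: V_def JA)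
    show "u + w \<in> V" if "u \<in> V" "w \<in> V" for u w
      using that g by (auto simp: V_def scalar_prod_add_distrib[of _ "2*n"])
    show "c \<cdot>\<^sub>v u \<in> V" if "u \<in> V" for c u
      using that g by (auto simp: V_def scalar_prod_smult_distrib[of _ "2*n"])
  qed (use v in \<open>auto simp: V_def\<close>)
  have xc: "x \<in> carrier_vec (2*n)" and yc: "y \<in> carrier_vec (2*n)"
    using x y by (auto simp: V_def)
  note c = xc yc J[OF xc] J[OF yc] Ac[OF xc] Ac[OF yc]
  \<comment> \<open>In the inner product given by \<open>A\<close>, the vectors J A u and u are
    orthogonal.\<close>
  have skew: "(?J *\<^sub>v (A *\<^sub>v u)) \<bullet> (A *\<^sub>v u) = 0" if "u \<in> carrier_vec (2*n)" for u
    using symplectic_form_self[OF Ac[OF that]] comm_scalar_prod[OF J[OF Ac[OF that]] Ac[OF that]] by simp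
  have sw: "y \<bullet> (A *\<^sub>v x) = x \<bullet> (A *\<^sub>v y)" by (rule positive_definite_form_swap[OF pd A yc xc])
  have nn: "0 \<le> u \<bullet> (A *\<^sub>v u)" if "u \<in> carrier_vec (2*n)" for u
  proof (cases "u = 0\<^sub>v (2*n)")
    case True
    then show ?thesis using scalar_prod_left_zero[OF Ac[OF that]] by simp
  next
    case False
    then show ?thesis using positive_definite_form_pos[OF pd A that] by simp
  qed
  have pos: "0 < x \<bullet> (A *\<^sub>v x) + y \<bullet> (A *\<^sub>v y)"
    using nz nn[OF xc] nn[OF yc] positive_definite_form_pos[OF pd A xc]
      positive_definite_form_pos[OF pd A yc] by (meson add_nonneg_pos add_pos_nonneg)
  \<comment> \<open>Insert the two eigenplane equations into skewness for \<open>x\<close> and for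
    \<open>y\<close>. By symmetry of \<open>A\<close> the terms with \<open>b\<close> cancel when
    \<open>e1\<close> and \<open>e2\<close> are added.\<close>
  have e1: "a * (x \<bullet> (A *\<^sub>v x)) - b * (y \<bullet> (A *\<^sub>v x)) = 0"
    using skew[OF xc] c unfolding JA[OF xc, symmetric] Mx
    by (simp add: add_scalar_prod_distrib[of _ "2*n"] del: uminus_carrier_vec)
  have e2: "b * (x \<bullet> (A *\<^sub>v y)) + a * (y \<bullet> (A *\<^sub>v y)) = 0"
    using skew[OF yc] c unfolding JA[OF yc, symmetric] My
    by (simp add: add_scalar_prod_distrib[of _ "2*n"])
  have "a * (x \<bullet> (A *\<^sub>v x) + y \<bullet> (A *\<^sub>v y)) = 0"
    using e1 e2 sw by (simp add: algebra_simps)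
  then have a0: "a = 0" using pos by simp
  \<comment> \<open>Applying J once more to J A x = -b y solves for A x, because J squares to
    -1.\<close>
  have Ax: "A *\<^sub>v x = b \<cdot>\<^sub>v (?J *\<^sub>v y)"
  proof -
    have "- (A *\<^sub>v x) = ?J *\<^sub>v (?J *\<^sub>v (A *\<^sub>v x))" using c by simp
    also have "?J *\<^sub>v (A *\<^sub>v x) = (- b) \<cdot>\<^sub>v y"
      using Mx xc yc unfolding JA[OF xc] by (intro eq_vecI) (auto simp: a0)
    also have "?J *\<^sub>v \<dots> = (- b) \<cdot>\<^sub>v (?J *\<^sub>v y)" by (rule mult_mat_vec[OF J_mat_carrier yc])
    finally have "- (- (A *\<^sub>v x)) = - ((- b) \<cdot>\<^sub>v (?J *\<^sub>v y))" by simp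
    then show ?thesis using c by (auto intro!: eq_vecI simp: uminus_uminus_vec)
  qed
  have Ay: "A *\<^sub>v y = (- b) \<cdot>\<^sub>v (?J *\<^sub>v x)"
  proof -
    have "- (A *\<^sub>v y) = ?J *\<^sub>v (?J *\<^sub>v (A *\<^sub>v y))" using c by simp
    also have "?J *\<^sub>v (A *\<^sub>v y) = b \<cdot>\<^sub>v x"
      using My xc yc unfolding JA[OF yc] by (intro eq_vecI) (auto simp: a0)
    also have "?J *\<^sub>v \<dots> = b \<cdot>\<^sub>v (?J *\<^sub>v x)" by (rule mult_mat_vec[OF J_mat_carrier xc])
    finally have "- (- (A *\<^sub>v y)) = - (b \<cdot>\<^sub>v (?J *\<^sub>v x))" by simp
    then show ?thesis using c by (auto intro!: eq_vecI simp: uminus_uminus_vec)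
  qed
  \<comment> \<open>Both \<open>x \<bullet> (A *\<^sub>v x)\<close> and
    \<open>y \<bullet> (A *\<^sub>v y)\<close> equal b w, so positivity makes \<open>b\<close> and
    \<open>w\<close> nonzero and of equal sign.\<close>
  define w where "w = x \<bullet> (?J *\<^sub>v y)"
  have "x \<bullet> (A *\<^sub>v x) + y \<bullet> (A *\<^sub>v y) = 2 * b * w"
    unfolding Ax Ay using c symplectic_form_swap[OF xc yc] by (simp add: w_def)
  then have bw: "0 < b * w" using pos by simp
  \<comment> \<open>Scaling both vectors by \<open>t\<close> makes the pairing 1 or -1. The extra
    factor \<open>sgn w\<close> on \<open>y\<close> corrects the sign and at the same time turns
    \<open>b\<close> into its absolute value.\<close>
  define t where "t = 1 / sqrt \<bar>w\<bar>"
  have t: "t * t * \<bar>w\<bar> = 1" using bw by (auto simp: t_def)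
  have b: "b = \<bar>b\<bar> * sgn w" "\<bar>b\<bar> = b * sgn w" "0 < \<bar>b\<bar>"
    using bw by (auto simp: zero_less_mult_iff)
  show ?thesis
  proof (rule exI[of _ "t \<cdot>\<^sub>v x"], rule exI[of _ "(sgn w * t) \<cdot>\<^sub>v y"], rule exI[of _ "\<bar>b\<bar>"], intro conjI)
    show "A *\<^sub>v (t \<cdot>\<^sub>v x) = \<bar>b\<bar> \<cdot>\<^sub>v (?J *\<^sub>v ((sgn w * t) \<cdot>\<^sub>v y))"
      unfolding mult_mat_vec[OF A xc] mult_mat_vec[OF J_mat_carrier yc] Ax smult_smult_assoc
      using b(1) by (simp add: mult_ac)
    show "A *\<^sub>v ((sgn w * t) \<cdot>\<^sub>v y) = (- \<bar>b\<bar>) \<cdot>\<^sub>v (?J *\<^sub>v (t \<cdot>\<^sub>v x))"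
      unfolding mult_mat_vec[OF A yc] mult_mat_vec[OF J_mat_carrier xc] Ay smult_smult_assoc b(2)
      by (simp add: mult_ac)
    have "(t \<cdot>\<^sub>v x) \<bullet> (?J *\<^sub>v ((sgn w * t) \<cdot>\<^sub>v y)) = t * t * (sgn w * w)"
      unfolding mult_mat_vec[OF J_mat_carrier yc] using c by (simp add: w_def)
    also have "sgn w * w = \<bar>w\<bar>" by (simp add: sgn_if abs_if)
    finally show "(t \<cdot>\<^sub>v x) \<bullet> (?J *\<^sub>v ((sgn w * t) \<cdot>\<^sub>v y)) = 1" by (simp add: t)
    show "\<forall>j<m. g j \<bullet> (t \<cdot>\<^sub>v x) = 0" "\<forall>j<m. g j \<bullet> ((sgn w * t) \<cdot>\<^sub>v y) = 0"
      using x y g by (auto simp: V_def scalar_prod_smult_distrib[of _ "2*n"])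
  qed (use c b in auto)
qed

text \<open>A partial Williamson basis, made of the planes split off so far. For
  \<open>k = n\<close> the vectors are the columns of a diagonalizing symplectic matrix.\<close>

definition symplectic_eigenfamily ::
  "nat \<Rightarrow> real mat \<Rightarrow> nat \<Rightarrow> (nat \<Rightarrow> real vec) \<Rightarrow> (nat \<Rightarrow> real vec) \<Rightarrow> (nat \<Rightarrow> real) \<Rightarrow> bool" where
  "symplectic_eigenfamily n A k x y d \<longleftrightarrow>
     (\<forall>i<k. x i \<in> carrier_vec (2*n) \<and> y i \<in> carrier_vec (2*n) \<and> 0 < d i \<and>
       A *\<^sub>v x i = d i \<cdot>\<^sub>v (J_mat n *\<^sub>v y i) \<and> A *\<^sub>v y i = (- d i) \<cdot>\<^sub>v (J_mat n *\<^sub>v x i)) \<and>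
     (\<forall>i<k. \<forall>j<k. x i \<bullet> (J_mat n *\<^sub>v x j) = 0 \<and> y i \<bullet> (J_mat n *\<^sub>v y j) = 0 \<and>
       x i \<bullet> (J_mat n *\<^sub>v y j) = (if i = j then 1 else 0))"

text \<open>The next pair is sought in the symplectic complement of the earlier ones. That
  complement is invariant under J A because the planes already found are.\<close>

lemma symplectic_eigenfamily_exists:
  assumes pd: "positive_definite A" and A: "A \<in> carrier_mat (2*n) (2*n)" and "k \<le> n"
  shows "\<exists>x y d. symplectic_eigenfamily n A k x y d"
proof -
  let ?J = "J_mat n"
  have J: "?J *\<^sub>v u \<in> carrier_vec (2*n)" if "u \<in> carrier_vec (2*n)" for u
    by (rule mult_mat_vec_carrier[OF J_mat_carrier that])
  have Ac: "A *\<^sub>v u \<in> carrier_vec (2*n)" if "u \<in> carrier_vec (2*n)" for u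
    by (rule mult_mat_vec_carrier[OF A that])
  show ?thesis
    using \<open>k \<le> n\<close>
  proof (induction k)
    case 0
    then show ?case by (simp add: symplectic_eigenfamily_def)
  next
    case (Suc k)
    then obtain x y d where F: "symplectic_eigenfamily n A k x y d" by auto
    have x: "x i \<in> carrier_vec (2*n)" and y: "y i \<in> carrier_vec (2*n)"
      and Ax: "A *\<^sub>v x i = d i \<cdot>\<^sub>v (?J *\<^sub>v y i)" and Ay: "A *\<^sub>v y i = (- d i) \<cdot>\<^sub>v (?J *\<^sub>v x i)"
      if "i < k" for i using F that by (simp_all add: symplectic_eigenfamily_def)
    \<comment> \<open>The common kernel of these 2k vectors is the symplectic complement of the
      pairs found so far.\<close>
    define g where "g j = ?J *\<^sub>v (if j < k then x j else y (j - k))" for j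
    have g: "g j \<in> carrier_vec (2*n)" if "j < 2*k" for j
      using that x y J by (auto simp: g_def)
    have inv: "g j \<bullet> (?J *\<^sub>v (A *\<^sub>v u)) = 0"
      if u: "u \<in> carrier_vec (2*n)" and orth: "\<forall>j<2*k. g j \<bullet> u = 0" and j: "j < 2*k" for u j
    proof -
      have gx: "(?J *\<^sub>v x i) \<bullet> u = 0" and gy: "(?J *\<^sub>v y i) \<bullet> u = 0" if "i < k" for i
        using orth[rule_format, of i] orth[rule_format, of "k + i"] that by (auto simp: g_def)
      define z where "z = (if j < k then x j else y (j - k))"
      have z: "z \<in> carrier_vec (2*n)" using j x y by (auto simp: z_def)
      have "g j \<bullet> (?J *\<^sub>v (A *\<^sub>v u)) = z \<bullet> (A *\<^sub>v u)"
        unfolding g_def z_def[symmetric] by (rule scalar_prod_J_J[OF z Ac[OF u]])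
      also have "\<dots> = u \<bullet> (A *\<^sub>v z)" by (rule positive_definite_form_swap[OF pd A z u])
      also have "\<dots> = (A *\<^sub>v z) \<bullet> u" by (rule comm_scalar_prod[OF u Ac[OF z]])
      \<comment> \<open>\<open>A *\<^sub>v z\<close> is a multiple of J applied to the partner of
        \<open>z\<close>, hence of one of the vectors orthogonal to \<open>u\<close>.\<close>
      also have "\<dots> = 0"
      proof (cases "j < k")
        case True
        then show ?thesis
          using gy[of j] J[OF y[of j]] u by (simp add: z_def Ax smult_scalar_prod_distrib[of _ "2*n"])
      next
        case False
        then have "j - k < k" using j by simp
        then show ?thesis
          using False gx[of "j - k"] J[OF x[of "j - k"]] u
          by (simp add: z_def Ay smult_scalar_prod_distrib[of _ "2*n"])
      qed
      finally show ?thesis .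
    qed
    have "2*k < 2*n" using Suc.prems by simp
    from symplectic_eigenpair[where g = g, OF pd A this g inv]
    obtain x' y' d' where x': "x' \<in> carrier_vec (2*n)" and y': "y' \<in> carrier_vec (2*n)"
      and new: "0 < d'" "A *\<^sub>v x' = d' \<cdot>\<^sub>v (?J *\<^sub>v y')" "A *\<^sub>v y' = (- d') \<cdot>\<^sub>v (?J *\<^sub>v x')"
      and xy: "x' \<bullet> (?J *\<^sub>v y') = 1"
      and gx: "\<forall>j<2*k. g j \<bullet> x' = 0" and gy: "\<forall>j<2*k. g j \<bullet> y' = 0"
      by blast
    have o: "u \<bullet> (?J *\<^sub>v x i) = 0" "u \<bullet> (?J *\<^sub>v y i) = 0" "x i \<bullet> (?J *\<^sub>v u) = 0" "y i \<bullet> (?J *\<^sub>v u) = 0"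
      if i: "i < k" and u: "u = x' \<or> u = y'" for i u
    proof -
      have uc: "u \<in> carrier_vec (2*n)" using u x' y' by auto
      have "g i \<bullet> u = 0" "g (k + i) \<bullet> u = 0" using gx gy u i by auto
      then show *: "u \<bullet> (?J *\<^sub>v x i) = 0" "u \<bullet> (?J *\<^sub>v y i) = 0"
        using i comm_scalar_prod[OF uc J[OF x[OF i]]] comm_scalar_prod[OF uc J[OF y[OF i]]]
        by (auto simp: g_def)
      show "x i \<bullet> (?J *\<^sub>v u) = 0" "y i \<bullet> (?J *\<^sub>v u) = 0"
        using * symplectic_form_swap[OF uc x[OF i]] symplectic_form_swap[OF uc y[OF i]] by auto
    qed
    have "symplectic_eigenfamily n A (Suc k) (x(k := x')) (y(k := y')) (d(k := d'))"
      using F x' y' new o xy symplectic_form_self[OF x'] symplectic_form_self[OF y']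
      by (simp add: symplectic_eigenfamily_def less_Suc_eq all_conj_distrib imp_conjR disj_imp
          conj_disj_distribL conj_disj_distribR)
    then show ?case by blast
  qed
qed

lemma direct_sum_diag_eq:
  assumes D: "D \<in> carrier_mat n n" "diagonal_mat D"
  shows "direct_sum_mat D D = double_diag n (\<lambda>i. D $$ (i, i))"
  by (rule eq_matI) (use D in \<open>auto simp: direct_sum_mat_def diagonal_mat_def\<close>)

lemma williamson_form_exists:
  assumes pd: "positive_definite A" and A: "A \<in> carrier_mat (2*n) (2*n)"
  shows "\<exists>D. williamson_form n A D"
proof -
  let ?J = "J_mat n"
  obtain x y d where F: "symplectic_eigenfamily n A n x y d"
    using symplectic_eigenfamily_exists[OF pd A order_refl] by blast
  have x: "x i \<in> carrier_vec (2*n)" and y: "y i \<in> carrier_vec (2*n)" and d: "0 < d i"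
    and Ax: "A *\<^sub>v x i = d i \<cdot>\<^sub>v (?J *\<^sub>v y i)" and Ay: "A *\<^sub>v y i = (- d i) \<cdot>\<^sub>v (?J *\<^sub>v x i)"
    if "i < n" for i using F that by (simp_all add: symplectic_eigenfamily_def)
  have xx: "x i \<bullet> (?J *\<^sub>v x j) = 0" and yy: "y i \<bullet> (?J *\<^sub>v y j) = 0"
    and xy: "x i \<bullet> (?J *\<^sub>v y j) = (if i = j then 1 else 0)" if "i < n" "j < n" for i j
    using F that by (simp_all add: symplectic_eigenfamily_def)
  have yx: "y i \<bullet> (?J *\<^sub>v x j) = (if i = j then -1 else 0)" if "i < n" "j < n" for i j
    using symplectic_form_swap[OF x[OF that(2)] y[OF that(1)]] xy[OF that(2,1)] by simp
  have J: "?J *\<^sub>v u \<in> carrier_vec (2*n)" if "u \<in> carrier_vec (2*n)" for u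
    by (rule mult_mat_vec_carrier[OF J_mat_carrier that])
  \<comment> \<open>The columns of the symplectic matrix: first all \<open>x i\<close>, then all
    \<open>y i\<close>.\<close>
  define z where "z c = (if c < n then x c else y (c - n))" for c
  have z: "z c \<in> carrier_vec (2*n)" if "c < 2*n" for c using that x y by (auto simp: z_def)
  define M where "M = mat (2*n) (2*n) (\<lambda>(r, c). z c $ r)"
  have M: "M \<in> carrier_mat (2*n) (2*n)" by (simp add: M_def)
  have col: "col M c = z c" if "c < 2*n" for c
    using that z[OF that] by (auto simp: M_def)
  have form: "z i \<bullet> (?J *\<^sub>v z j) = ?J $$ (i, j)" if "i < 2*n" "j < 2*n" for i j
    using that by (auto simp: z_def index_J_mat xx yy xy yx)
  have "symplectic_mat n M"
    unfolding symplectic_mat_def using M form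
    by (auto intro!: eq_matI simp: index_congruence[OF M J_mat_carrier] col simp del: index_mult_mat(1))
  moreover have "transpose_mat M * A * M = double_diag n d"
  proof (rule eq_matI)
    fix i j assume "i < dim_row (double_diag n d)" "j < dim_col (double_diag n d)"
    then have ij: "i < 2*n" "j < 2*n" by auto
    \<comment> \<open>Since \<open>A\<close> maps each column to a multiple of J applied to its
      partner, these products reduce to the symplectic pairings already known.\<close>
    have "z i \<bullet> (A *\<^sub>v z j) = double_diag n d $$ (i, j)"
      using ij x y J by (auto simp: z_def Ax Ay scalar_prod_smult_distrib[of _ "2*n"] xx yy xy yx)
    then show "(transpose_mat M * A * M) $$ (i, j) = double_diag n d $$ (i, j)"
      unfolding index_congruence[OF M A ij] using ij by (simp add: col)
  qed (use M in auto)
  moreover define D where "D = mat n n (\<lambda>(i, j). if i = j then d i else 0)"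
  have D: "D \<in> carrier_mat n n" "diagonal_mat D" by (auto simp: D_def diagonal_mat_def)
  have "direct_sum_mat D D = double_diag n d"
    unfolding direct_sum_diag_eq[OF D] by (rule eq_matI) (auto simp: D_def)
  ultimately have "williamson_form n A D"
    using D d by (auto simp: williamson_form_def D_def)
  then show ?thesis by blast
qed

section \<open>Sorted Williamson forms, extremal partial sums and uniqueness\<close>

lemma sort_as_permutation:
  obtains f where "bij_betw f {..<length xs} {..<length xs}"
    and "\<And>i. i < length xs \<Longrightarrow> sort xs ! i = xs ! f i"
  using permutation_Ex_bij[of "sort xs" xs] by auto

lemma williamson_form_diag:
  assumes "williamson_form n A D"
  shows "length (sort (diag_mat D)) = n" "\<And>i. i < n \<Longrightarrow> 0 < sort (diag_mat D) ! i"
proof -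
  have D: "D \<in> carrier_mat n n" "\<forall>i<n. D $$ (i, i) > 0"
    using assms by (auto simp: williamson_form_def)
  then show len: "length (sort (diag_mat D)) = n" by (simp add: diag_mat_def)
  show "0 < sort (diag_mat D) ! i" if "i < n" for i
  proof -
    have "sort (diag_mat D) ! i \<in> set (diag_mat D)"
      using that len by (metis nth_mem set_sort)
    then show ?thesis using D by (auto simp: diag_mat_def)
  qed
qed

text \<open>Applying the sorting permutation to both halves of the columns of \<open>M\<close> at
  once sorts the two diagonal blocks and keeps the pairing of conjugate columns, so the matrix stays
  symplectic.\<close>

lemma williamson_form_sorted:
  assumes A: "A \<in> carrier_mat (2*n) (2*n)" and W: "williamson_form n A D"
  obtains M where "symplectic_mat n M"
    and "transpose_mat M * A * M = double_diag n (\<lambda>i. sort (diag_mat D) ! i)"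
proof -
  obtain M where D: "D \<in> carrier_mat n n" "diagonal_mat D"
    and M: "symplectic_mat n M" and MAM: "transpose_mat M * A * M = direct_sum_mat D D"
    using W by (auto simp: williamson_form_def)
  have Mc: "M \<in> carrier_mat (2*n) (2*n)" and MJM: "transpose_mat M * J_mat n * M = J_mat n"
    using M by (auto simp: symplectic_mat_def)
  have len: "length (diag_mat D) = n" using D by (simp add: diag_mat_def)
  obtain f where bij: "bij_betw f {..<n} {..<n}"
    and f: "\<And>i. i < n \<Longrightarrow> sort (diag_mat D) ! i = diag_mat D ! f i"
    using sort_as_permutation[of "diag_mat D"] unfolding len by blast
  have fn: "f i < n" if "i < n" for i using bij that by (auto simp: bij_betw_def)
  have inj: "f i = f j \<longleftrightarrow> i = j" if "i < n" "j < n" for i j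
    using bij that by (auto simp: bij_betw_def inj_on_def)
  define h where "h c = (if c < n then f c else n + f (c - n))" for c
  have h: "h c < 2*n" if "c < 2*n" for c
    using that fn[of c] fn[of "c - n"] by (auto simp: h_def)
  define M' where "M' = mat (2*n) (2*n) (\<lambda>(r, c). M $$ (r, h c))"
  have M': "M' \<in> carrier_mat (2*n) (2*n)" by (simp add: M'_def)
  have col: "col M' c = col M (h c)" if "c < 2*n" for c
    using that h[OF that] Mc by (intro eq_vecI) (auto simp: M'_def)
  have cong: "(transpose_mat M' * B * M') $$ (i, j) = (transpose_mat M * B * M) $$ (h i, h j)"
    if "B \<in> carrier_mat (2*n) (2*n)" "i < 2*n" "j < 2*n" for B i j
    using that h col by (simp add: index_congruence[OF M'] index_congruence[OF Mc] del: index_mult_mat(1))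
  have lt: "i - n < n" if "i < 2*n" "\<not> i < n" for i using that by linarith
  \<comment> \<open>The relation \<open>j = n + i\<close> marks the nonzero entries of
    \<open>J_mat n\<close>, and \<open>h\<close> respects it because it acts alike on the two
    halves.\<close>
  have hn: "h j = n + h i \<longleftrightarrow> j = n + i" if "i < 2*n" "j < 2*n" for i j
  proof (cases "j < n")
    case True
    then show ?thesis using fn[of j] by (simp add: h_def)
  next
    case False
    then show ?thesis
      using that fn[of "j - n"] inj[of "j - n" i] lt[of j] by (auto simp: h_def)
  qed
  have "transpose_mat M' * J_mat n * M' = J_mat n"
  proof (rule eq_matI)
    fix i j assume "i < dim_row (J_mat n)" "j < dim_col (J_mat n)"
    then have ij: "i < 2*n" "j < 2*n" by auto
    have "(transpose_mat M' * J_mat n * M') $$ (i, j) = J_mat n $$ (h i, h j)"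
      using cong[OF J_mat_carrier ij] by (simp only: MJM)
    also have "\<dots> = J_mat n $$ (i, j)"
      unfolding index_J_mat[OF h h, OF ij] index_J_mat[OF ij] using hn[OF ij] hn[OF ij(2,1)] by simp
    finally show "(transpose_mat M' * J_mat n * M') $$ (i, j) = J_mat n $$ (i, j)" .
  qed (use M' in auto)
  then have "symplectic_mat n M'" using M' by (simp add: symplectic_mat_def)
  moreover have "transpose_mat M' * A * M' = double_diag n (\<lambda>i. sort (diag_mat D) ! i)"
  proof (rule eq_matI)
    fix i j assume "i < dim_row (double_diag n (\<lambda>i. sort (diag_mat D) ! i))"
      "j < dim_col (double_diag n (\<lambda>i. sort (diag_mat D) ! i))"
    then have ij: "i < 2*n" "j < 2*n" by auto
    have eq: "h i = h j \<longleftrightarrow> i = j"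
      using ij lt inj[of i j] inj[of "i - n" "j - n"] fn[of i] fn[of j] by (auto simp: h_def)
    have dg: "sort (diag_mat D) ! i = D $$ (f i, f i)" if "i < n" for i
      using that f fn D by (simp add: diag_mat_def)
    have "(transpose_mat M' * A * M') $$ (i, j) = double_diag n (\<lambda>i. D $$ (i, i)) $$ (h i, h j)"
      using cong[OF A ij] by (simp only: MAM direct_sum_diag_eq[OF D])
    also have "\<dots> = double_diag n (\<lambda>i. sort (diag_mat D) ! i) $$ (i, j)"
      using ij h eq lt fn by (auto simp: h_def dg)
    finally show "(transpose_mat M' * A * M') $$ (i, j) = double_diag n (\<lambda>i. sort (diag_mat D) ! i) $$ (i, j)" .
  qed (use M' in auto)
  ultimately show ?thesis using that by blast
qed

lemma williamson_partial_sum_le: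
  fixes s :: "nat \<Rightarrow> real vec"
  assumes A: "A \<in> carrier_mat (2*n) (2*n)" and W: "williamson_form n A D"
    and "k \<le> n"
    and "\<And>c. c < 2*k \<Longrightarrow> s c \<in> carrier_vec (2*n)"
    and "\<And>c c'. c < 2*k \<Longrightarrow> c' < 2*k \<Longrightarrow> s c \<bullet> (J_mat n *\<^sub>v s c') = J_mat k $$ (c, c')"
  shows "2 * (\<Sum>j<k. sort (diag_mat D) ! j) \<le> (\<Sum>c<2*k. s c \<bullet> (A *\<^sub>v s c))"
proof -
  obtain M where M: "symplectic_mat n M"
    "transpose_mat M * A * M = double_diag n (\<lambda>i. sort (diag_mat D) ! i)"
    by (rule williamson_form_sorted[OF A W])
  show ?thesis
  proof (rule symplectic_family_bound[OF A M assms(3-5)])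
    show "sort (diag_mat D) ! i \<le> sort (diag_mat D) ! j" if "i \<le> j" "j < n" for i j
      using that williamson_form_diag(1)[OF W] by (intro sorted_nth_mono) auto
  qed (use williamson_form_diag(2)[OF W] in \<open>auto intro: less_imp_le\<close>)
qed

text \<open>The first \<open>k\<close> columns of each half of a sorted Williamson basis are
  optimal: each conjugate pair contributes its diagonal entry twice.\<close>

lemma williamson_partial_sum_attained:
  assumes A: "A \<in> carrier_mat (2*n) (2*n)" and W: "williamson_form n A D" and k: "k \<le> n"
  obtains s where "\<And>c. c < 2*k \<Longrightarrow> s c \<in> carrier_vec (2*n)"
    and "\<And>c c'. c < 2*k \<Longrightarrow> c' < 2*k \<Longrightarrow> s c \<bullet> (J_mat n *\<^sub>v s c') = J_mat k $$ (c, c')"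
    and "(\<Sum>c<2*k. s c \<bullet> (A *\<^sub>v s c)) = 2 * (\<Sum>j<k. sort (diag_mat D) ! j)"
proof -
  define e where "e i = sort (diag_mat D) ! i" for i
  obtain M where M: "symplectic_mat n M" and MAM: "transpose_mat M * A * M = double_diag n e"
    unfolding e_def by (rule williamson_form_sorted[OF A W])
  have Mc: "M \<in> carrier_mat (2*n) (2*n)" and MJM: "transpose_mat M * J_mat n * M = J_mat n"
    using M by (auto simp: symplectic_mat_def)
  define h where "h c = (if c < k then c else n + (c - k))" for c
  have h: "h c < 2*n" if "c < 2*k" for c
    using that k by (auto simp: h_def)
  define s where "s c = col M (h c)" for c
  have quad: "s c \<bullet> (A *\<^sub>v s c) = double_diag n e $$ (h c, h c)" if "c < 2*k" for c
    unfolding s_def using index_congruence[OF Mc A h h, OF that that] MAM by simp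
  show ?thesis
  proof (rule that[of s])
    show "s c \<in> carrier_vec (2*n)" for c
      using Mc col_dim[of M "h c"] by (simp add: s_def)
    show "s c \<bullet> (J_mat n *\<^sub>v s c') = J_mat k $$ (c, c')" if c: "c < 2*k" "c' < 2*k" for c c'
    proof -
      have "s c \<bullet> (J_mat n *\<^sub>v s c') = J_mat n $$ (h c, h c')"
        unfolding s_def using index_congruence[OF Mc J_mat_carrier h h, OF c] MJM by simp
      also have "\<dots> = J_mat k $$ (c, c')"
        using c h k by (auto simp: index_J_mat h_def)
      finally show ?thesis .
    qed
    have "(\<Sum>c<2*k. s c \<bullet> (A *\<^sub>v s c)) = (\<Sum>c<2*k. double_diag n e $$ (h c, h c))"
      by (auto intro!: sum.cong simp: quad)
    also have "\<dots> = 2 * (\<Sum>j<k. e j)"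
      unfolding sum_double using k by (auto simp: h_def sum_distrib_left intro!: sum.cong)
    finally show "(\<Sum>c<2*k. s c \<bullet> (A *\<^sub>v s c)) = 2 * (\<Sum>j<k. sort (diag_mat D) ! j)"
      by (simp add: e_def)
  qed
qed

text \<open>An optimal family for one form is admissible in the bound for the other, so all partial
  sums agree. The entries are the differences of consecutive partial sums.\<close>

lemma williamson_form_unique:
  assumes A: "A \<in> carrier_mat (2*n) (2*n)" and D: "williamson_form n A D" "williamson_form n A D'"
  shows "sort (diag_mat D) = sort (diag_mat D')"
proof -
  have le: "(\<Sum>j<k. sort (diag_mat D) ! j) \<le> (\<Sum>j<k. sort (diag_mat D') ! j)"
    if k: "k \<le> n" and D: "williamson_form n A D" and D': "williamson_form n A D'" for k D D'
  proof -
    obtain s where "\<And>c. c < 2*k \<Longrightarrow> s c \<in> carrier_vec (2*n)"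
      "\<And>c c'. c < 2*k \<Longrightarrow> c' < 2*k \<Longrightarrow> s c \<bullet> (J_mat n *\<^sub>v s c') = J_mat k $$ (c, c')"
      "(\<Sum>c<2*k. s c \<bullet> (A *\<^sub>v s c)) = 2 * (\<Sum>j<k. sort (diag_mat D') ! j)"
      using williamson_partial_sum_attained[OF A D' k] by blast
    then show ?thesis using williamson_partial_sum_le[OF A D k, of s] by simp
  qed
  have eq: "(\<Sum>j<k. sort (diag_mat D) ! j) = (\<Sum>j<k. sort (diag_mat D') ! j)" if "k \<le> n" for k
    using le[OF that] D by (meson order_antisym)
  show ?thesis
  proof (rule nth_equalityI)
    show "length (sort (diag_mat D)) = length (sort (diag_mat D'))"
      using williamson_form_diag(1) D by metis
    fix i assume "i < length (sort (diag_mat D))"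
    then have "i < n" using williamson_form_diag(1)[OF D(1)] by simp
    then show "sort (diag_mat D) ! i = sort (diag_mat D') ! i"
      using eq[of i] eq[of "Suc i"] by simp
  qed
qed

lemma symplectic_eigenvalues_eq:
  assumes A: "A \<in> carrier_mat (2*n) (2*n)" and D: "williamson_form n A D"
  shows "symplectic_eigenvalues n A = vec_of_list (sort (diag_mat D))"
  unfolding symplectic_eigenvalues_def
  by (rule the_equality) (use D williamson_form_unique[OF A] in metis)+

section \<open>Pinching\<close>

text \<open>Multiplication by U = diag(I, -I).\<close>

definition flip_vec :: "nat \<Rightarrow> real vec \<Rightarrow> real vec" where
  "flip_vec n v = vec (2*n) (\<lambda>i. if i < n then v $ i else - v $ i)"

lemma flip_vec_carrier [simp]: "flip_vec n v \<in> carrier_vec (2*n)"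
  by (simp add: flip_vec_def)

lemma symplectic_form_flip:
  assumes "u \<in> carrier_vec (2*n)" "v \<in> carrier_vec (2*n)"
  shows "flip_vec n u \<bullet> (J_mat n *\<^sub>v flip_vec n v) = - (u \<bullet> (J_mat n *\<^sub>v v))"
  unfolding symplectic_form_eq[OF assms] symplectic_form_eq[OF flip_vec_carrier flip_vec_carrier]
  by (simp add: flip_vec_def sum_negf[symmetric])

lemma quadratic_form_eq_sum:
  fixes A :: "'a::comm_semiring_0 mat"
  assumes "A \<in> carrier_mat N N" "v \<in> carrier_vec N"
  shows "v \<bullet> (A *\<^sub>v v) = (\<Sum>i<N. \<Sum>j<N. v $ i * (A $$ (i, j) * v $ j))"
  using assms by (auto simp: scalar_prod_def sum_distrib_left lessThan_atLeast0 intro!: sum.cong)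

text \<open>Conjugation by U leaves the blocks \<open>E\<close> and \<open>G\<close> alone and
  reverses the sign of the off-diagonal blocks, which therefore cancel in the sum.\<close>

lemma block_diagonal_quadratic_form:
  fixes E F G :: "real mat"
  assumes E: "E \<in> carrier_mat n n" and F: "F \<in> carrier_mat n n" and G: "G \<in> carrier_mat n n"
    and A: "A = four_block_mat E F (transpose_mat F) G" and v: "v \<in> carrier_vec (2*n)"
  shows "2 * (v \<bullet> (direct_sum_mat E G *\<^sub>v v)) =
    v \<bullet> (A *\<^sub>v v) + flip_vec n v \<bullet> (A *\<^sub>v flip_vec n v)"
proof -
  have Ac: "A \<in> carrier_mat (2*n) (2*n)" and B: "direct_sum_mat E G \<in> carrier_mat (2*n) (2*n)"
    using E F G by (auto simp: A direct_sum_mat_def)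
  show ?thesis
    unfolding quadratic_form_eq_sum[OF Ac v] quadratic_form_eq_sum[OF B v]
      quadratic_form_eq_sum[OF Ac flip_vec_carrier] sum_distrib_left sum.distrib[symmetric]
    by (intro sum.cong) (use E F G in \<open>auto simp: A direct_sum_mat_def flip_vec_def\<close>)
qed

text \<open>The form of E (+) G is the average of two values of the form of \<open>A\<close>, taken
  at \<open>v\<close> and at its flip, and both vectors are nonzero.\<close>

lemma positive_definite_block_diagonal:
  assumes E: "E \<in> carrier_mat n n" and F: "F \<in> carrier_mat n n" and G: "G \<in> carrier_mat n n"
    and A: "A = four_block_mat E F (transpose_mat F) G" and pd: "positive_definite A"
  shows "positive_definite (direct_sum_mat E G)"
proof -
  have Ac: "A \<in> carrier_mat (2*n) (2*n)" and B: "direct_sum_mat E G \<in> carrier_mat (2*n) (2*n)"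
    using E F G by (auto simp: A direct_sum_mat_def)
  have "transpose_mat A = A" using pd by (simp add: positive_definite_def)
  then have sym: "A $$ (j, i) = A $$ (i, j)" if "i < 2*n" "j < 2*n" for i j
    using Ac that by (metis carrier_matD index_transpose_mat(1))
  have ent: "direct_sum_mat E G $$ (i, j) = (if i < n \<longleftrightarrow> j < n then A $$ (i, j) else 0)"
    if "i < 2*n" "j < 2*n" for i j
    using that E F G by (auto simp: A direct_sum_mat_def)
  have "transpose_mat (direct_sum_mat E G) = direct_sum_mat E G"
    by (rule eq_matI) (use B in \<open>auto simp: ent sym\<close>)
  moreover have "0 < v \<bullet> (direct_sum_mat E G *\<^sub>v v)"
    if v: "v \<in> carrier_vec (2*n)" "v \<noteq> 0\<^sub>v (2*n)" for v
  proof -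
    obtain i where "i < 2*n" "v $ i \<noteq> 0"
      using v by (metis carrier_vecD eq_vecI index_zero_vec)
    then have "flip_vec n v $ i \<noteq> 0\<^sub>v (2*n) $ i" by (simp add: flip_vec_def)
    then have "flip_vec n v \<noteq> 0\<^sub>v (2*n)" by metis
    then show ?thesis
      using block_diagonal_quadratic_form[OF E F G A v(1)] positive_definite_form_pos[OF pd Ac v]
        positive_definite_form_pos[OF pd Ac flip_vec_carrier] by fastforce
  qed
  ultimately show ?thesis using B by (auto simp: positive_definite_def)
qed

theorem theorem3p2:
  fixes n :: nat and A E F G :: "real mat"
  assumes "n \<ge> 1"
    and "E \<in> carrier_mat n n" and "F \<in> carrier_mat n n" and "G \<in> carrier_mat n n"
    and "A = four_block_mat E F (transpose_mat F) G"
    and "positive_definite A"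
  shows "weakly_supermajorized n
           (symplectic_eigenvalues n (direct_sum_mat E G))
           (symplectic_eigenvalues n A)"
proof -
  let ?B = "direct_sum_mat E G"
  have A: "A \<in> carrier_mat (2*n) (2*n)" and B: "?B \<in> carrier_mat (2*n) (2*n)"
    using assms by (auto simp: direct_sum_mat_def)
  obtain DA where DA: "williamson_form n A DA"
    using williamson_form_exists[OF assms(6) A] by blast
  obtain DB where DB: "williamson_form n ?B DB"
    using williamson_form_exists[OF positive_definite_block_diagonal[OF assms(2-6)] B] by blast
  have "(\<Sum>j<k. sort (diag_mat DA) ! j) \<le> (\<Sum>j<k. sort (diag_mat DB) ! j)" if k: "k \<le> n" for k
  proof -
    obtain s where s: "\<And>c. c < 2*k \<Longrightarrow> s c \<in> carrier_vec (2*n)"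
      and symp: "\<And>c c'. c < 2*k \<Longrightarrow> c' < 2*k \<Longrightarrow> s c \<bullet> (J_mat n *\<^sub>v s c') = J_mat k $$ (c, c')"
      and sum: "(\<Sum>c<2*k. s c \<bullet> (?B *\<^sub>v s c)) = 2 * (\<Sum>j<k. sort (diag_mat DB) ! j)"
      using williamson_partial_sum_attained[OF B DB k] by blast
    \<comment> \<open>Exchanging the two halves of the family reverses the sign of its Gram matrix.
      This compensates for the sign that \<open>flip_vec\<close> introduces, so the flipped family
      is admissible.\<close>
    define h where "h c = (if c < k then k + c else c - k)" for c
    have h: "h c < 2*k" if "c < 2*k" for c using that by (auto simp: h_def)
    have hk: "h j = k + h i \<longleftrightarrow> i = k + j" if "i < 2*k" "j < 2*k" for i j
      using that by (cases "i < k"; cases "j < k") (auto simp: h_def)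
    have "2 * (\<Sum>j<k. sort (diag_mat DA) ! j) \<le> (\<Sum>c<2*k. s c \<bullet> (A *\<^sub>v s c))"
      by (rule williamson_partial_sum_le[OF A DA k s symp])
    moreover have "2 * (\<Sum>j<k. sort (diag_mat DA) ! j) \<le>
        (\<Sum>c<2*k. flip_vec n (s (h c)) \<bullet> (A *\<^sub>v flip_vec n (s (h c))))"
    proof (rule williamson_partial_sum_le[OF A DA k flip_vec_carrier])
      fix c c' assume c: "c < 2*k" "c' < 2*k"
      have "flip_vec n (s (h c)) \<bullet> (J_mat n *\<^sub>v flip_vec n (s (h c'))) = - J_mat k $$ (h c, h c')"
        using symplectic_form_flip[OF s s, OF h h, OF c] symp[OF h h, OF c] by simp
      also have "\<dots> = J_mat k $$ (c, c')"
        unfolding index_J_mat[OF h h, OF c] index_J_mat[OF c] hk[OF c] hk[OF c(2,1)] using c by simp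
      finally show "flip_vec n (s (h c)) \<bullet> (J_mat n *\<^sub>v flip_vec n (s (h c'))) = J_mat k $$ (c, c')" .
    qed
    \<comment> \<open>The exchange only permutes the terms of the trace.\<close>
    moreover have "(\<Sum>c<2*k. flip_vec n (s (h c)) \<bullet> (A *\<^sub>v flip_vec n (s (h c)))) =
        (\<Sum>c<2*k. flip_vec n (s c) \<bullet> (A *\<^sub>v flip_vec n (s c)))"
      unfolding sum_double by (auto simp: h_def add.commute intro!: sum.cong)
    ultimately have "4 * (\<Sum>j<k. sort (diag_mat DA) ! j) \<le>
        (\<Sum>c<2*k. s c \<bullet> (A *\<^sub>v s c) + flip_vec n (s c) \<bullet> (A *\<^sub>v flip_vec n (s c)))"
      by (simp add: sum.distrib)
    also have "\<dots> = 2 * (\<Sum>c<2*k. s c \<bullet> (?B *\<^sub>v s c))"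
      unfolding sum_distrib_left
      by (rule sum.cong) (use block_diagonal_quadratic_form[OF assms(2-5) s] in auto)
    finally show ?thesis unfolding sum by simp
  qed
  moreover have "vec_of_list (sort (diag_mat D)) \<in> carrier_vec n" if "williamson_form n C D" for C D
    using williamson_form_diag(1)[OF that] by (intro carrier_vecI) simp
  \<comment> \<open>The eigenvalue vectors are sorted already, so the sorting in
    \<open>weakly_supermajorized\<close> leaves them unchanged.\<close>
  ultimately show ?thesis
    unfolding weakly_supermajorized_def symplectic_eigenvalues_eq[OF A DA]
      symplectic_eigenvalues_eq[OF B DB] list_vec sorted_sort_id[OF sorted_sort]
    using DA DB by blast
qed

end
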